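(* Let $G$ be a connected graph with diameter $4$. Then $vcfc(G)\leq 3$. Moreover, $cfc(G)=2$ if $h(G)\leq 1$, and $cfc(G)=h(G)$ if $h(G)\geq 3$.
   Context: All graphs are simple, finite and undirected. In an edge-colored (respectively vertex-colored) graph, where colorings are arbitrary and not required to be proper, a path is called conflict-free if there is a color used on exactly one of its edges (respectively vertices). The colored graph is conflict-free connected (respectively conflict-free vertex-connected) if every pair of distinct vertices is connected by a conflict-free path. For a connected graph $G$, the conflict-free connection number $cfc(G)$ (respectively conflict-free vertex-connection number $vcfc(G)$) is the smallest number of colors in an edge-coloring (respectively vertex-coloring) that makes $G$ conflict-free connected (respectively conflict-free vertex-connected). For a connected graph $G$, let $C(G)$ be the subgraph of $G$ induced by the set of cut-edges (bridges) of $G$, that is, the subgraph consisting of all cut-edges and their end-vertices; it is a forest. Define $h(G)=\max\{cfc(T): T \text{ is a component of } C(G)\}$, with $h(G)=0$ if $G$ has no cut-edge. *)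

theory Defs
  imports "Graph_Theory.Graph_Theory"
begin

text \<open>
  A simple finite undirected graph is a \<open>graph\<close> of the Graph_Theory library: every undirected edge
  \<open>{u, v}\<close> is represented by the two arcs \<open>(u, v)\<close> and \<open>(v, u)\<close>. An edge-coloring must give both
  arcs the same color, so colors are assigned to the sets \<open>{u, v}\<close>.
\<close>

definition edge_of :: "('a, 'b) pre_digraph \<Rightarrow> 'b \<Rightarrow> 'a set" where
  "edge_of G a = {tail G a, head G a}"

definition edges :: "('a, 'b) pre_digraph \<Rightarrow> 'a set set" where
  "edges G = edge_of G ` arcs G"

text \<open>The supremum is \<open>\<infinity>\<close> if some vertex is unreachable from another one.\<close>

definition graph_diameter :: "('a, 'b) pre_digraph \<Rightarrow> ereal" where
  "graph_diameter G = (SUP u \<in> verts G. SUP v \<in> verts G. wf_digraph.\<mu> G (\<lambda>_. 1) u v)"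

definition conflict_free_path ::
    "('a, 'b) pre_digraph \<Rightarrow> ('a set \<Rightarrow> 'c) \<Rightarrow> 'b awalk \<Rightarrow> bool" where
  "conflict_free_path G c p \<longleftrightarrow> (\<exists>k. card {e \<in> edge_of G ` set p. c e = k} = 1)"

definition conflict_free_vertex_path ::
    "('a, 'b) pre_digraph \<Rightarrow> ('a \<Rightarrow> 'c) \<Rightarrow> 'a \<Rightarrow> 'b awalk \<Rightarrow> bool" where
  "conflict_free_vertex_path G c u p \<longleftrightarrow>
     (\<exists>k. card {x \<in> set (pre_digraph.awalk_verts G u p). c x = k} = 1)"

definition conflict_free_connected :: "('a, 'b) pre_digraph \<Rightarrow> ('a set \<Rightarrow> 'c) \<Rightarrow> bool" where
  "conflict_free_connected G c \<longleftrightarrow>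
     (\<forall>u \<in> verts G. \<forall>v \<in> verts G. u \<noteq> v \<longrightarrow>
        (\<exists>p. pre_digraph.apath G u p v \<and> conflict_free_path G c p))"

definition conflict_free_vertex_connected :: "('a, 'b) pre_digraph \<Rightarrow> ('a \<Rightarrow> 'c) \<Rightarrow> bool" where
  "conflict_free_vertex_connected G c \<longleftrightarrow>
     (\<forall>u \<in> verts G. \<forall>v \<in> verts G. u \<noteq> v \<longrightarrow>
        (\<exists>p. pre_digraph.apath G u p v \<and> conflict_free_vertex_path G c u p))"

text \<open>Natural numbers serve as colors; graphs being finite, this is no restriction.\<close>

definition cfc :: "('a, 'b) pre_digraph \<Rightarrow> nat" where
  "cfc G = (LEAST k. \<exists>c :: 'a set \<Rightarrow> nat. card (c ` edges G) = k \<and> conflict_free_connected G c)"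

definition vcfc :: "('a, 'b) pre_digraph \<Rightarrow> nat" where
  "vcfc G = (LEAST k. \<exists>c :: 'a \<Rightarrow> nat. card (c ` verts G) = k \<and> conflict_free_vertex_connected G c)"

definition delete_edge :: "('a, 'b) pre_digraph \<Rightarrow> 'a set \<Rightarrow> ('a, 'b) pre_digraph" where
  "delete_edge G e = G\<lparr>arcs := {a \<in> arcs G. edge_of G a \<noteq> e}\<rparr>"

text \<open>Only meaningful for connected \<open>G\<close>.\<close>

definition cut_edges :: "('a, 'b) pre_digraph \<Rightarrow> 'a set set" where
  "cut_edges G = {e \<in> edges G. \<not> connected (delete_edge G e)}"

definition cut_edge_graph :: "('a, 'b) pre_digraph \<Rightarrow> ('a, 'b) pre_digraph" where
  "cut_edge_graph G =
     G\<lparr>verts := \<Union>(cut_edges G), arcs := {a \<in> arcs G. edge_of G a \<in> cut_edges G}\<rparr>"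

text \<open>
  The graph \<open>cut_edge_graph G\<close> is symmetric if \<open>G\<close> is, and the strongly connected components of a
  symmetric digraph are the components of the undirected graph.
\<close>

definition h_number :: "('a, 'b) pre_digraph \<Rightarrow> nat" where
  "h_number G = (if cut_edges G = {} then 0
                 else Max (cfc ` pre_digraph.sccs (cut_edge_graph G)))"

end

theory Submission
  imports Defs
begin

text \<open>
  Call two edges cocyclic if they lie on a common cycle; this is an equivalence relation on the
  edges that are not bridges. Let \<open>S\<close> contain exactly one edge of each class. Deleting \<open>S\<close> leaves \<open>G\<close>
  connected, and if some \<open>u\<close>-\<open>v\<close> path avoiding \<open>S\<close> contains a non-bridge, it can be rerouted so that it
  contains exactly one edge of \<open>S\<close>. All \<open>u\<close>-\<open>v\<close> paths contain the same bridges. If \<open>h(G) \<le> 1\<close>, it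
  therefore suffices to give \<open>S\<close> one color and all other edges another one. If \<open>h(G) \<ge> 3\<close>, use an
  optimal coloring on each component of \<open>C(G)\<close> and the colors 0, 1, 2 on two disjoint such sets and on
  the remaining non-bridges; as a shortest path with a non-bridge has at most three bridges, one of
  the colors 0 and 1 can always be made to occur exactly once. Conversely, a path along bridges is the
  only path between its ends, so \<open>cfc(T) \<le> cfc(G)\<close> for each component \<open>T\<close>.

  For the vertex-coloring, diameter 4 provides a center \<open>c\<close> such that no two cut vertices lie one
  behind the other as seen from \<open>c\<close>. Color \<open>c\<close>, the other cut vertices, and all remaining vertices
  with three colors. Two vertices without a path through \<open>c\<close> are separated from \<open>c\<close> by a cut vertex \<open>a\<close>
  (the case \<open>k = 2\<close> of Menger's theorem), and then they are joined by a path through \<open>a\<close> on which \<open>a\<close>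
  is the only cut vertex.
\<close>

section \<open>Paths as lists of vertices\<close>

fun path_edges :: "'a list \<Rightarrow> 'a set set" where
  "path_edges (x # y # zs) = insert {x, y} (path_edges (y # zs))"
| "path_edges _ = {}"

text \<open>Paths are not tied to a vertex set: \<open>[u]\<close> is one for every \<open>u\<close>
  and every \<open>E\<close>. Membership in \<open>V\<close> is recovered by
  \<open>upath_in_V\<close>.\<close>

definition upath :: "'a set set \<Rightarrow> 'a \<Rightarrow> 'a list \<Rightarrow> 'a \<Rightarrow> bool" where
  "upath E u xs v \<longleftrightarrow> xs \<noteq> [] \<and> hd xs = u \<and> last xs = v \<and> distinct xs \<and> path_edges xs \<subseteq> E"

definition joined :: "'a set set \<Rightarrow> 'a \<Rightarrow> 'a \<Rightarrow> bool" where
  "joined E u v \<longleftrightarrow> (\<exists>xs. upath E u xs v)"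

lemma distinct_split_unique:
  assumes "distinct (xs @ x # ys)" "xs @ x # ys = xs' @ x # ys'"
  shows "xs = xs'" "ys = ys'"
proof -
  have "x \<notin> set xs" "x \<notin> set ys" using assms(1) by auto
  then show "xs = xs'" "ys = ys'" using append_Cons_eq_iff assms(2) by metis+
qed

lemma path_edges_Cons:
  "path_edges (x # xs) = (if xs = [] then {} else insert {x, hd xs} (path_edges xs))"
  by (cases xs) auto

lemma path_edges_append:
  "path_edges (xs @ ys) = path_edges xs \<union> path_edges ys \<union>
     (if xs = [] \<or> ys = [] then {} else {{last xs, hd ys}})"
  by (induction xs) (auto simp: path_edges_Cons)

lemma path_edges_append_Cons:
  "path_edges (xs @ x # ys) = path_edges (xs @ [x]) \<union> path_edges (x # ys)"
  by (auto simp: path_edges_append)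

lemma path_edges_rev [simp]: "path_edges (rev xs) = path_edges xs"
  by (induction xs) (auto simp: path_edges_append path_edges_Cons last_rev insert_commute)

lemma finite_path_edges [simp]: "finite (path_edges xs)"
  by (induction xs) (auto simp: path_edges_Cons)

lemma path_edges_subset: "e \<in> path_edges xs \<Longrightarrow> e \<subseteq> set xs"
  by (induction xs) (auto simp: path_edges_Cons split: if_splits)

lemma path_edges_split:
  assumes "e \<in> path_edges xs"
  obtains ys zs where "xs = ys @ zs" "ys \<noteq> []" "zs \<noteq> []" "e = {last ys, hd zs}"
  using assms
proof (induction xs arbitrary: thesis)
  case (Cons x xs)
  then consider "xs \<noteq> []" "e = {x, hd xs}" | "e \<in> path_edges xs"
    by (auto simp: path_edges_Cons split: if_splits)
  then show ?case
  proof cases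
    case 1
    then show ?thesis using Cons.prems(1)[of "[x]" xs] by simp
  next
    case 2
    then obtain ys zs where "xs = ys @ zs" "ys \<noteq> []" "zs \<noteq> []" "e = {last ys, hd zs}"
      using Cons.IH by blast
    then show ?thesis using Cons.prems(1)[of "x # ys" zs] by simp
  qed
qed simp

text \<open>The first edge contains the first vertex, which no later edge does. Hence a shortest
  path has the fewest edges, and five vertices amount to four edges.\<close>

lemma card_path_edges: "distinct xs \<Longrightarrow> card (path_edges xs) = length xs - 1"
proof (induction xs)
  case (Cons x xs)
  have "{x, hd xs} \<notin> path_edges xs"
    using path_edges_subset[of "{x, hd xs}" xs] Cons.prems by auto
  then show ?case
    using Cons by (cases xs) (auto simp: path_edges_Cons)
qed simp

lemma upath_mono: "upath E u xs v \<Longrightarrow> path_edges xs \<subseteq> F \<Longrightarrow> upath F u xs v"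
  by (auto simp: upath_def)

lemma upath_rev: "upath E u xs v \<Longrightarrow> upath E v (rev xs) u"
  by (auto simp: upath_def hd_rev last_rev)

lemma upath_refl: "upath E u [u] u"
  by (simp add: upath_def)

lemma upath_appendD:
  assumes "upath E u (xs @ ys) v" "xs \<noteq> []" "ys \<noteq> []"
  shows "upath E u xs (last xs)" "upath E (hd ys) ys v" "{last xs, hd ys} \<in> E"
    "set xs \<inter> set ys = {}"
  using assms by (auto simp: upath_def path_edges_append)

lemma upath_splitD:
  assumes "upath E u (xs @ x # ys) v"
  shows "upath E u (xs @ [x]) x" "upath E x (x # ys) v"
  using assms by (auto simp: upath_def path_edges_append path_edges_Cons hd_append split: if_splits)

lemma upath_glue:
  assumes "upath E u (xs @ [x]) x" "upath E x (x # ys) v" "set xs \<inter> set ys = {}"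
  shows "upath E u (xs @ x # ys) v"
  using assms by (auto simp: upath_def path_edges_append path_edges_Cons hd_append split: if_splits)

text \<open>The first path is left at its first vertex \<open>z\<close> on the second one. The
  decompositions are exposed because later arguments must know which vertices the new path can
  use.\<close>

lemma upath_concat:
  assumes "upath E u xs v" "upath E v ys w"
  obtains as z bs cs ds where "xs = as @ z # bs" "ys = cs @ z # ds" "set as \<inter> set ys = {}"
    "upath E u (as @ z # ds) w"
proof -
  have "\<exists>x\<in>set xs. x \<in> set ys"
    using assms by (metis upath_def last_in_set hd_in_set)
  then obtain as z bs where 1: "xs = as @ z # bs" "z \<in> set ys" "\<forall>a\<in>set as. a \<notin> set ys"
    using split_list_first_prop[of xs "\<lambda>x. x \<in> set ys"] by blast
  then obtain cs ds where 2: "ys = cs @ z # ds"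
    by (meson split_list)
  have "upath E u (as @ z # ds) w"
    using 1 2 assms upath_splitD upath_glue[of E u as z ds w]
    by (metis Un_iff disjoint_iff list.set_intros(2) set_append)
  with 1 2 that show thesis by blast
qed

lemma joined_refl [simp]: "joined E u u"
  unfolding joined_def by (blast intro: upath_refl)

lemma joined_sym: "joined E u v \<Longrightarrow> joined E v u"
  unfolding joined_def by (blast intro: upath_rev)

lemma joined_trans [trans]: "joined E u v \<Longrightarrow> joined E v w \<Longrightarrow> joined E u w"
  unfolding joined_def by (metis upath_concat)

lemma joined_edge: "{u, v} \<in> E \<Longrightarrow> joined E u v"
  by (cases "u = v") (auto simp: joined_def upath_def intro!: exI[of _ "[u, v]"])

text \<open>Each edge of a path in \<open>E\<close> is replaced by a path in \<open>F\<close>. This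
  is how connectivity survives the deletion of edges that can be bypassed.\<close>

lemma joined_subst:
  assumes "\<And>x y. {x, y} \<in> E \<Longrightarrow> joined F x y" "joined E u v"
  shows "joined F u v"
proof -
  have "joined F u v" if "upath E u xs v" for xs
    using that
  proof (induction xs arbitrary: u)
    case (Cons x xs)
    show ?case
    proof (cases "xs = []")
      case False
      then have "upath E (hd xs) xs v" "{u, hd xs} \<in> E"
        using Cons.prems by (auto simp: upath_def path_edges_Cons)
      then show ?thesis using joined_trans[OF assms(1) Cons.IH] by simp
    qed (use Cons in \<open>auto simp: upath_def\<close>)
  qed (simp add: upath_def)
  then show ?thesis using assms(2) unfolding joined_def[of E] by blast
qed

text \<open>
  The cycle is given as the edge \<open>{x, y}\<close> together with the path \<open>D\<close>. Leave \<open>P\<close> at its first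
  vertex on the cycle, re-enter it at its last one, and go around the side that contains \<open>{x, y}\<close>.
\<close>

lemma upath_via_cycle_edge:
  assumes P: "upath E u P v" and D: "upath E x D y" and s: "{x, y} \<in> E"
    and f: "f \<in> path_edges P" "f \<in> path_edges D" "card f = 2"
  obtains Q where "upath E u Q v" "{x, y} \<in> path_edges Q"
    "path_edges Q \<subseteq> insert {x, y} (path_edges P \<union> path_edges D)"
proof -
  \<comment> \<open>Here \<open>p\<close> and \<open>q\<close>, the first and the last vertex of
    \<open>P\<close> on \<open>D\<close>, occur in this order on \<open>D\<close> too; reversing
    \<open>D\<close> gives the other case.\<close>
  have key: "\<exists>Q. upath E u Q v \<and> {x, y} \<in> path_edges Q \<and>
      path_edges Q \<subseteq> insert {x, y} (path_edges P \<union> path_edges D)"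
    if D: "upath E x D y" and s: "{x, y} \<in> E" and PP: "P = P1 @ p # M @ q # P4"
      and P1: "set P1 \<inter> set D = {}" and P4: "set P4 \<inter> set D = {}"
      and DD: "D = D1 @ p # D2 @ q # D3" for P1 p M q P4 D D1 D2 D3 x y
  proof -
    have x: "x = hd (D1 @ [p])" and y: "y = last (q # D3)"
      using D DD by (auto simp: upath_def hd_append)
    \<comment> \<open>From \<open>p\<close> back along \<open>D\<close> to \<open>x\<close>, across
      \<open>{x, y}\<close>, and from \<open>y\<close> back along \<open>D\<close> to
      \<open>q\<close>.\<close>
    define Q where "Q = (P1 @ rev (D1 @ [p])) @ (rev (q # D3) @ P4)"
    have "distinct Q"
      using P D P1 P4 unfolding upath_def Q_def PP DD by auto
    moreover have "Q \<noteq> []" "hd Q = u"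
      using P unfolding upath_def Q_def PP by (cases P1; auto)+
    moreover have "last Q = v"
      using P unfolding upath_def Q_def PP by (cases P4 rule: rev_cases) auto
    moreover have eq: "path_edges Q = insert {x, y}
        (path_edges (P1 @ rev (D1 @ [p])) \<union> path_edges (rev (q # D3) @ P4))"
      unfolding Q_def by (subst path_edges_append) (auto simp: x y last_rev hd_append hd_rev)
    moreover have sub: "path_edges Q \<subseteq> insert {x, y} (path_edges P \<union> path_edges D)"
    proof -
      have "path_edges (P1 @ rev (D1 @ [p])) = path_edges (P1 @ [p]) \<union> path_edges (D1 @ [p])"
        using path_edges_append_Cons[of P1 p "rev D1"] path_edges_rev[of "D1 @ [p]"] by simp
      moreover have "path_edges (rev (q # D3) @ P4) = path_edges (q # D3) \<union> path_edges (q # P4)"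
        using path_edges_append_Cons[of "rev D3" q P4] path_edges_rev[of "q # D3"] by simp
      moreover have "path_edges P = path_edges (P1 @ [p]) \<union> path_edges (p # M @ [q]) \<union> path_edges (q # P4)"
        using path_edges_append_Cons[of P1 p "M @ q # P4"] path_edges_append_Cons[of "p # M" q P4]
        unfolding PP by auto
      moreover have "path_edges D = path_edges (D1 @ [p]) \<union> path_edges (p # D2 @ [q]) \<union> path_edges (q # D3)"
        using path_edges_append_Cons[of D1 p "D2 @ q # D3"] path_edges_append_Cons[of "p # D2" q D3]
        unfolding DD by auto
      ultimately show ?thesis unfolding eq by blast
    qed
    moreover have "path_edges Q \<subseteq> E"
      using P D s sub by (auto simp: upath_def)
    ultimately show ?thesis unfolding upath_def by blast
  qed
  have fP: "f \<subseteq> set P" and fD: "f \<subseteq> set D" using f path_edges_subset by auto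
  obtain a b where ab: "f = {a, b}" "a \<noteq> b" using f(3) by (auto simp: card_2_iff)
  have meet: "\<exists>x\<in>set P. x \<in> set D" using fP fD ab by auto
  obtain P1 p P2 where p: "P = P1 @ p # P2" "p \<in> set D" "\<forall>z\<in>set P1. z \<notin> set D"
    using split_list_first_prop[of P "\<lambda>x. x \<in> set D"] meet by blast
  obtain P3 q P4 where q: "P = P3 @ q # P4" "q \<in> set D" "\<forall>z\<in>set P4. z \<notin> set D"
    using split_list_last_prop[of P "\<lambda>x. x \<in> set D"] meet by blast
  \<comment> \<open>Both ends of \<open>f\<close> lie on \<open>P\<close> and on \<open>D\<close>,
    so the two paths share at least two vertices.\<close>
  have ne: "p \<noteq> q"
  proof
    assume "p = q"
    then have "P1 = P3 \<and> P2 = P4"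
      using p(1) q(1) P distinct_split_unique[of P1 p P2 P3 P4] by (simp add: upath_def)
    then show False using p q ab fP fD by auto
  qed
  have "q \<in> set P" using q(1) by simp
  then have "q \<in> set P2" using p q(2) ne by auto
  then obtain M P4' where M: "P2 = M @ q # P4'" by (meson split_list)
  have "P = (P1 @ p # M) @ q # P4'" using M p by simp
  then have "P4' = P4"
    using q(1) P distinct_split_unique(2)[of "P1 @ p # M" q P4' P3 P4] by (metis upath_def)
  then have PP: "P = P1 @ p # M @ q # P4" using M p by simp
  have order: "(\<exists>D1 D2 D3. D = D1 @ p # D2 @ q # D3) \<or> (\<exists>D1 D2 D3. D = D1 @ q # D2 @ p # D3)"
  proof -
    obtain D1 D2 where D1: "D = D1 @ p # D2" using p(2) by (meson split_list)
    then consider "q \<in> set D1" | "q \<in> set D2" using q(2) ne by auto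
    then show ?thesis
    proof cases
      case 1
      then obtain D3 D4 where "D1 = D3 @ q # D4" by (meson split_list)
      then have "D = D3 @ q # D4 @ p # D2" using D1 by simp
      then show ?thesis by blast
    next
      case 2
      then obtain D3 D4 where "D2 = D3 @ q # D4" by (meson split_list)
      then have "D = D1 @ p # D3 @ q # D4" using D1 by simp
      then show ?thesis by blast
    qed
  qed
  have d: "set P1 \<inter> set D = {}" "set P4 \<inter> set D = {}" using p q by auto
  have rev_key: "\<exists>Q. upath E u Q v \<and> {x, y} \<in> path_edges Q \<and>
      path_edges Q \<subseteq> insert {x, y} (path_edges P \<union> path_edges D)"
    if "D = D1 @ q # D2 @ p # D3" for D1 D2 D3
  proof -
    have rD: "rev D = rev D3 @ p # rev D2 @ q # rev D1" using that by simp
    have s': "{y, x} \<in> E" using s by (simp add: insert_commute)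
    have d': "set P1 \<inter> set (rev D) = {}" "set P4 \<inter> set (rev D) = {}" using d by auto
    from key[OF upath_rev[OF D] s' PP d' rD] show ?thesis
      by (simp only: path_edges_rev insert_commute[of y x])
  qed
  have "\<exists>Q. upath E u Q v \<and> {x, y} \<in> path_edges Q \<and>
      path_edges Q \<subseteq> insert {x, y} (path_edges P \<union> path_edges D)"
    using order key[OF D s PP d] rev_key by (elim disjE exE)
  then show thesis using that by (elim exE conjE)
qed

section \<open>Separating vertices\<close>

definition separates :: "'a set set \<Rightarrow> 'a \<Rightarrow> 'a \<Rightarrow> 'a \<Rightarrow> bool" where
  "separates E a x y \<longleftrightarrow> x \<noteq> a \<and> y \<noteq> a \<and> (\<forall>xs. upath E x xs y \<longrightarrow> a \<in> set xs)"

lemma separates_sym: "separates E a x y \<Longrightarrow> separates E a y x"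
  unfolding separates_def using upath_rev by fastforce

text \<open>\<open>W\<close> replaces the part of \<open>P\<close> between \<open>r\<close> and
  \<open>t\<close>; if \<open>t\<close> comes first on \<open>P\<close>, then \<open>rev W\<close>
  is used.\<close>

lemma upath_through_ear:
  assumes P: "upath E u P v" and W: "upath E r W t" and ends: "set W \<inter> set P = {r, t}" "r \<noteq> t"
  shows "\<exists>Q. upath E u Q v \<and> set W \<subseteq> set Q"
proof -
  have key: "\<exists>Q. upath E u Q v \<and> set W \<subseteq> set Q"
    if W: "upath E r W t" and ends: "set W \<inter> set P = {r, t}" and PP: "P = P1 @ r # M @ t # P4"
    for r t W P1 M P4
  proof -
    obtain Wi where Wi: "W = Wi @ [t]"
      using W by (metis append_butlast_last_id upath_def)
    obtain Wt where Wt: "W = r # Wt"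
      using W by (metis list.collapse upath_def)
    have d: "distinct P" "distinct W" using P W by (auto simp: upath_def)
    have "upath E u (P1 @ [r]) r" using P upath_splitD PP by metis
    moreover have "set P1 \<inter> set Wt = {}"
      using ends d PP Wt by auto
    ultimately have "upath E u (P1 @ W) t"
      using W Wt upath_glue by metis
    then have 1: "upath E u ((P1 @ Wi) @ [t]) t" using Wi by simp
    have "P = (P1 @ r # M) @ t # P4" using PP by simp
    then have 2: "upath E t (t # P4) v" using P upath_splitD by metis
    have "set (P1 @ Wi) \<inter> set P4 = {}"
      using ends d PP Wi by auto
    from upath_glue[OF 1 2 this] show ?thesis
      using Wi by (intro exI[of _ "(P1 @ Wi) @ t # P4"]) auto
  qed
  obtain P1 P2 where P1: "P = P1 @ r # P2"
    using ends by (metis IntD2 insertI1 split_list)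
  have "t \<in> set P" using ends by auto
  then consider "t \<in> set P1" | "t \<in> set P2" using P1 ends(2) by auto
  then show ?thesis
  proof cases
    case 1
    then obtain M N where "P1 = M @ t # N" by (meson split_list)
    then have PP: "P = M @ t # N @ r # P2" using P1 by simp
    have "set (rev W) \<inter> set P = {t, r}" using ends by auto
    from key[OF upath_rev[OF W] this PP] show ?thesis by simp
  next
    case 2
    then obtain M N where "P2 = M @ t # N" by (meson split_list)
    then have PP: "P = P1 @ r # M @ t # N" using P1 by simp
    from key[OF W ends(1) PP] show ?thesis .
  qed
qed

text \<open>Edges as two-element sets keep the combinatorics free of the two arcs per edge;
  \<open>connected_graph_edges\<close> supplies the instance.\<close>

locale connected_graph =
  fixes V :: "'a set" and E :: "'a set set"
  assumes edge_ends: "e \<in> E \<Longrightarrow> \<exists>x y. e = {x, y} \<and> x \<noteq> y \<and> x \<in> V \<and> y \<in> V"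
    and joined_all: "\<lbrakk>u \<in> V; v \<in> V\<rbrakk> \<Longrightarrow> joined E u v"
begin

lemma card_edge: "e \<in> E \<Longrightarrow> card e = 2"
  using edge_ends card_2_iff by metis

lemma upath_in_V: "upath E u xs v \<Longrightarrow> u \<in> V \<Longrightarrow> set xs \<subseteq> V"
proof (induction xs arbitrary: u)
  case (Cons x xs)
  show ?case
  proof (cases "xs = []")
    case False
    then have "upath E (hd xs) xs v" "{x, hd xs} \<in> E" and x: "x = u"
      using Cons.prems by (auto simp: upath_def path_edges_Cons)
    moreover from this have "hd xs \<in> V" using edge_ends[of "{x, hd xs}"] by (auto simp: doubleton_eq_iff)
    ultimately show ?thesis using Cons by auto
  qed (use Cons in \<open>auto simp: upath_def\<close>)
qed simp

text \<open>
  Let \<open>R\<close> be the set of vertices on \<open>u\<close>-\<open>v\<close> paths. If \<open>c\<close> could be joined to two vertices of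
  \<open>R\<close> outside of \<open>R\<close>, these two paths together with a part of a \<open>u\<close>-\<open>v\<close> path would form an ear of
  another \<open>u\<close>-\<open>v\<close> path, which then could be rerouted outside of \<open>R\<close>.
\<close>

lemma ex_separator_of_no_path_through:
  assumes V: "u \<in> V" "v \<in> V" "c \<in> V"
    and no: "\<And>xs. upath E u xs v \<Longrightarrow> c \<notin> set xs"
  obtains a where "a \<noteq> c" "u = a \<or> separates E a u c" "v = a \<or> separates E a v c"
proof -
  define R where "R = {w. \<exists>xs. upath E u xs v \<and> w \<in> set xs}"
  have cR: "c \<notin> R" using no by (auto simp: R_def)
  obtain P0 where "upath E u P0 v" using joined_all V by (auto simp: joined_def)
  moreover from this have "u \<in> set P0" "v \<in> set P0"
    by (auto simp: upath_def)
  ultimately have uvR: "u \<in> R" "v \<in> R" by (auto simp: R_def)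
  have to_R: "\<exists>ys r. upath E c (ys @ [r]) r \<and> r \<in> R \<and> set ys \<inter> R = {} \<and> set (ys @ [r]) \<subseteq> set xs"
    if "upath E c xs w" "w \<in> R" for xs w
  proof -
    have "\<exists>x\<in>set xs. x \<in> R" using that by (metis last_in_set upath_def)
    then obtain ys r zs where "xs = ys @ r # zs" "r \<in> R" "\<forall>y\<in>set ys. y \<notin> R"
      using split_list_first_prop[of xs "\<lambda>x. x \<in> R"] by blast
    then show ?thesis using that upath_splitD(1)[of E c ys r zs w]
      by (intro exI[of _ ys] exI[of _ r]) auto
  qed
  \<comment> \<open>The vertex \<open>r1\<close> at which a path from \<open>c\<close> enters
    \<open>R\<close> is the candidate for \<open>a\<close>.\<close>
  obtain C0 where "upath E c C0 u" using joined_all V by (auto simp: joined_def)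
  from to_R[OF this uvR(1)] obtain C1 r1 where C1: "upath E c (C1 @ [r1]) r1" "r1 \<in> R" "set C1 \<inter> R = {}"
    by auto
  show thesis
  proof (rule ccontr)
    assume "\<not> thesis"
    moreover have "r1 \<noteq> c" using C1(2) cR by auto
    ultimately have "\<not> (u = r1 \<or> separates E r1 u c) \<or> \<not> (v = r1 \<or> separates E r1 v c)"
      using that[of r1] by blast
    then obtain w where w: "w \<in> {u, v}" "w \<noteq> r1" "\<not> separates E r1 w c"
      by blast
    \<comment> \<open>If \<open>r1\<close> does not separate, a path between \<open>w\<close> and
      \<open>c\<close> avoids it and yields a second entry \<open>r2\<close> into
      \<open>R\<close>.\<close>
    then obtain C2 where C2: "upath E w C2 c" "r1 \<notin> set C2"
      using C1(2) cR by (auto simp: separates_def)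
    have "w \<in> R" using w uvR by auto
    from to_R[OF upath_rev[OF C2(1)] this] obtain C3 r2
      where C3: "upath E c (C3 @ [r2]) r2" "r2 \<in> R" "set C3 \<inter> R = {}" "set (C3 @ [r2]) \<subseteq> set C2"
      by auto
    have r12: "r1 \<noteq> r2" using C2 C3 by auto
    \<comment> \<open>The two ways from \<open>c\<close> into \<open>R\<close> meet in
      \<open>z\<close> and combine to \<open>W\<close>, which has only its ends in
      \<open>R\<close>.\<close>
    obtain as z bs cs ds where z: "rev (C1 @ [r1]) = as @ z # bs" "C3 @ [r2] = cs @ z # ds"
      and W: "upath E r1 (as @ z # ds) r2"
      using upath_concat[OF upath_rev[OF C1(1)] C3(1)] by metis
    define W where "W = as @ z # ds"
    have W': "upath E r1 W r2" using W W_def by simp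
    have zin: "z \<in> set (C1 @ [r1])" "z \<in> set (C3 @ [r2])"
      by (metis z in_set_conv_decomp set_rev)+
    then have zR: "z \<notin> R" using C1 C3 r12 by auto
    have "set W \<subseteq> set (C1 @ [r1]) \<union> set (C3 @ [r2])"
    proof -
      have "set as \<subseteq> set (rev (C1 @ [r1]))" unfolding z(1) by auto
      moreover have "set (z # ds) \<subseteq> set (C3 @ [r2])" unfolding z(2) by auto
      ultimately show ?thesis unfolding W_def by auto
    qed
    then have WR: "set W \<inter> R \<subseteq> {r1, r2}" using C1 C3 by auto
    have r1W: "r1 \<in> set W" using W' by (auto simp: upath_def)
    obtain P1 where P1: "upath E u P1 v" "r1 \<in> set P1" using C1(2) by (auto simp: R_def)
    then have P1R: "set P1 \<subseteq> R" by (auto simp: R_def)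
    have uvP1: "u \<in> set P1" "v \<in> set P1" using P1 by (auto simp: upath_def)
    obtain P2 where P2: "upath E u P2 v" "r2 \<in> set P2" using C3(2) by (auto simp: R_def)
    then have P2R: "set P2 \<subseteq> R" by (auto simp: R_def)
    obtain X Y where XY: "P2 = X @ r2 # Y" using P2(2) by (meson split_list)
    have dP2: "distinct P2" using P2 by (simp add: upath_def)
    \<comment> \<open>From \<open>r2\<close>, follow \<open>P2\<close> towards \<open>u\<close> or
      \<open>v\<close>, choosing the side that does not contain \<open>r1\<close>.\<close>
    have "\<exists>T t. upath E r2 T t \<and> t \<in> set P1 \<and> set T \<subseteq> R \<and> r1 \<notin> set T"
    proof (cases "r1 \<in> set Y")
      case False
      then show ?thesis using upath_splitD(2)[of E u X r2 Y v] P2 XY uvP1 P2R r12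
        by (intro exI[of _ "r2 # Y"] exI[of _ v]) auto
    next
      case True
      then have "r1 \<notin> set X" using dP2 XY by auto
      then show ?thesis
        using upath_rev[OF upath_splitD(1)[of E u X r2 Y v]] P2 XY uvP1 P2R r12
        by (intro exI[of _ "rev (X @ [r2])"] exI[of _ u]) auto
    qed
    then obtain T t where T: "upath E r2 T t" "t \<in> set P1" "set T \<subseteq> R" "r1 \<notin> set T" by auto
    have "\<exists>x\<in>set T. x \<in> set P1" using T by (metis last_in_set upath_def)
    then obtain T1 q T2 where q: "T = T1 @ q # T2" "q \<in> set P1" "\<forall>x\<in>set T1. x \<notin> set P1"
      using split_list_first_prop[of T "\<lambda>x. x \<in> set P1"] by blast
    then have Tq: "upath E r2 (T1 @ [q]) q" using T upath_splitD by metis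
    obtain T' where T': "T1 @ [q] = r2 # T'" using Tq by (metis list.collapse upath_def)
    obtain W1 where W1: "W = W1 @ [r2]"
      using W' by (metis append_butlast_last_id upath_def)
    have dW: "distinct W" and dT: "distinct (T1 @ [q])" using W' Tq by (auto simp: upath_def)
    have T'R: "set (T1 @ [q]) \<subseteq> R" "r1 \<notin> set (T1 @ [q])" using T q by auto
    have "set W1 \<inter> set T' = {}"
    proof -
      have "set W1 \<inter> R \<subseteq> {r1}" using WR dW W1 by auto
      then show ?thesis using T'R T' by auto
    qed
    \<comment> \<open>\<open>W\<close> is prolonged from \<open>r2\<close> to the first vertex
      \<open>q\<close> of \<open>T\<close> on \<open>P1\<close>; this makes it an ear of
      \<open>P1\<close>.\<close>
    then have N: "upath E r1 (W1 @ r2 # T') q"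
      using upath_glue[of E r1 W1 r2 T' q] W' W1 Tq T' by simp
    have "set (W1 @ r2 # T') = set W \<union> set (T1 @ [q])" using W1 T' by auto
    moreover have "r2 \<in> set P1 \<Longrightarrow> r2 = q"
      using T' q(3) by (cases T1) auto
    ultimately have "set (W1 @ r2 # T') \<inter> set P1 = {r1, q}"
      using WR P1R q P1(2) r1W by auto
    moreover have "r1 \<noteq> q" using T'R by auto
    \<comment> \<open>Rerouting \<open>P1\<close> through the ear puts \<open>z\<close> on a path
      from \<open>u\<close> to \<open>v\<close>, against \<open>z \<notin> R\<close>.\<close>
    ultimately obtain Q where "upath E u Q v" "set (W1 @ r2 # T') \<subseteq> set Q"
      using upath_through_ear[OF P1(1) N] by blast
    moreover have "z \<in> set (W1 @ r2 # T')" using W1 by (metis W_def in_set_conv_decomp append_Cons append_assoc append_Nil)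
    ultimately show False using zR by (auto simp: R_def)
  qed
qed

end

section \<open>Bridges and cocyclic edges\<close>

context connected_graph
begin

text \<open>A local form of the cut-edge condition that looks only at the ends of the edge;
  \<open>cut_edges_eq_bridges\<close> identifies it with \<open>cut_edges\<close>.\<close>

definition bridges :: "'a set set" where
  "bridges = {e \<in> E. \<exists>x y. e = {x, y} \<and> \<not> joined (E - {e}) x y}"

text \<open>The path \<open>D\<close> and the edge \<open>s\<close> form the common cycle; in particular \<open>f \<noteq> s\<close>.\<close>

definition cocyclic :: "'a set \<Rightarrow> 'a set \<Rightarrow> bool" where
  "cocyclic f s \<longleftrightarrow> (\<exists>x y D. s = {x, y} \<and> upath (E - {s}) x D y \<and> f \<in> path_edges D)"

lemma joined_of_not_bridge: "\<lbrakk>{x, y} \<in> E; {x, y} \<notin> bridges\<rbrakk> \<Longrightarrow> joined (E - {{x, y}}) x y"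
  unfolding bridges_def by blast

lemma not_bridge_of_joined: "joined (E - {{x, y}}) x y \<Longrightarrow> {x, y} \<notin> bridges"
  unfolding bridges_def using joined_sym by (fastforce simp: doubleton_eq_iff)

lemma cocyclic_in_E: "cocyclic f s \<Longrightarrow> f \<in> E"
  unfolding cocyclic_def upath_def by blast

lemma not_cocyclic_self: "\<not> cocyclic f f"
  unfolding cocyclic_def upath_def by blast

text \<open>The cycle is cut open at \<open>f\<close> instead of \<open>s\<close>: the part of
  \<open>D\<close> before \<open>f\<close> backwards, then \<open>s\<close>, then the part after
  \<open>f\<close> backwards.\<close>

lemma cocyclic_sym:
  assumes "cocyclic f s" "s \<in> E"
  shows "cocyclic s f"
proof -
  obtain x y D where D: "s = {x, y}" "upath (E - {s}) x D y" "f \<in> path_edges D"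
    using assms by (auto simp: cocyclic_def)
  obtain ys zs where yz: "D = ys @ zs" "ys \<noteq> []" "zs \<noteq> []" "f = {last ys, hd zs}"
    using path_edges_split[OF D(3)] .
  have xy: "x = hd ys" "y = last zs" using D(2) yz by (auto simp: upath_def)
  have d: "distinct (ys @ zs)" using D(2) yz by (simp add: upath_def)
  have "f \<noteq> s" using D by (auto simp: upath_def)
  have pe: "path_edges (rev ys @ rev zs) = insert s (path_edges ys \<union> path_edges zs)"
    using yz D(1) xy by (simp add: path_edges_append last_rev hd_rev)
  have "f \<notin> path_edges ys \<union> path_edges zs"
  proof
    assume "f \<in> path_edges ys \<union> path_edges zs"
    then have "f \<subseteq> set ys \<or> f \<subseteq> set zs" using path_edges_subset by blast
    moreover have "last ys \<in> set ys" "hd zs \<in> set zs" using yz by auto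
    ultimately show False using d yz(4) by auto
  qed
  moreover have "path_edges ys \<union> path_edges zs \<subseteq> E"
    using D(2) yz(1) by (auto simp: upath_def path_edges_append)
  ultimately have "upath (E - {f}) (last ys) (rev ys @ rev zs) (hd zs)"
    using pe \<open>f \<noteq> s\<close> assms(2) d yz by (auto simp: upath_def hd_rev last_rev)
  then show ?thesis
    unfolding cocyclic_def using yz(4) pe by blast
qed

text \<open>If \<open>f\<close> is not on the cycle through \<open>g\<close> and \<open>s\<close>,
  then the path that closes the cycle through \<open>f\<close> and \<open>g\<close> shares the edge
  \<open>g\<close> with it. Rerouted over \<open>s\<close>, it still closes a cycle with
  \<open>f\<close>.\<close>

lemma cocyclic_trans:
  assumes gf: "cocyclic g f" and gs: "cocyclic g s" and E: "f \<in> E" "s \<in> E" and ne: "f \<noteq> s"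
  shows "cocyclic f s"
proof -
  obtain u v P where P: "f = {u, v}" "upath (E - {f}) u P v" "g \<in> path_edges P"
    using gf by (auto simp: cocyclic_def)
  obtain x y D where D: "s = {x, y}" "upath (E - {s}) x D y" "g \<in> path_edges D"
    using gs by (auto simp: cocyclic_def)
  show ?thesis
  proof (cases "f \<in> path_edges D")
    case True
    then show ?thesis using D by (auto simp: cocyclic_def)
  next
    case False
    have "upath E u P v" "upath E x D y"
      using P D by (auto simp: upath_def)
    moreover have "card g = 2" using card_edge cocyclic_in_E gf by blast
    moreover have "{x, y} \<in> E" using E D by simp
    ultimately obtain Q where Q: "upath E u Q v" "{x, y} \<in> path_edges Q"
      "path_edges Q \<subseteq> insert {x, y} (path_edges P \<union> path_edges D)"
      using upath_via_cycle_edge P(3) D(3) by metis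
    have "f \<notin> path_edges Q" using Q(3) False ne D(1) P(2) by (auto simp: upath_def)
    then have "upath (E - {f}) u Q v" using Q(1) by (auto simp: upath_def)
    then have "cocyclic s f" using Q(2) P(1) D(1) by (auto simp: cocyclic_def)
    then show ?thesis using cocyclic_sym E by blast
  qed
qed

lemma cocyclic_not_bridge:
  assumes "cocyclic f s" "s \<in> E"
  shows "s \<notin> bridges" "f \<notin> bridges"
proof -
  have *: "s \<notin> bridges" if "cocyclic f s" for f s
    using that not_bridge_of_joined unfolding cocyclic_def joined_def by metis
  show "s \<notin> bridges" "f \<notin> bridges" using *[OF assms(1)] *[OF cocyclic_sym[OF assms]] by auto
qed

lemma ex_cocyclic:
  assumes "f \<in> E - bridges"
  shows "\<exists>g. cocyclic g f"
proof -
  obtain x y where xy: "f = {x, y}" "x \<noteq> y" using assms edge_ends by blast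
  then obtain D where D: "upath (E - {f}) x D y" using assms joined_of_not_bridge by (metis DiffE joined_def)
  then have "path_edges D \<noteq> {}"
    using xy(2) by (cases D rule: path_edges.cases) (auto simp: upath_def)
  then show ?thesis using D xy by (auto simp: cocyclic_def)
qed

text \<open>The diagonal is added since \<open>cocyclic\<close> is irreflexive.\<close>

lemma equiv_cocyclic:
  "equiv (E - bridges) {(f, g). f \<in> E - bridges \<and> g \<in> E - bridges \<and> (f = g \<or> cocyclic f g)}"
    (is "equiv _ ?r")
  unfolding equiv_def
proof (intro conjI)
  show "?r \<subseteq> (E - bridges) \<times> (E - bridges)" by blast
  show "refl_on (E - bridges) ?r" by (auto simp: refl_on_def)
  show "sym ?r"
    using cocyclic_sym by (auto simp: sym_def)
  show "trans ?r"
  proof (rule transI)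
    fix f g h
    assume "(f, g) \<in> ?r" "(g, h) \<in> ?r"
    then show "(f, h) \<in> ?r" using cocyclic_trans[of g f h] cocyclic_sym[of f g] by auto
  qed
qed

section \<open>Transversals of the classes of cocyclic edges\<close>

definition transversal :: "'a set set \<Rightarrow> bool" where
  "transversal S \<longleftrightarrow> S \<subseteq> E - bridges \<and> (\<forall>f\<in>E - bridges. \<exists>s\<in>S. f = s \<or> cocyclic f s) \<and>
     (\<forall>s\<in>S. \<forall>t\<in>S. \<not> cocyclic s t)"

text \<open>A non-bridge lies on a cycle with further edges, so every class offers two different
  representatives.\<close>

lemma ex_disjoint_transversals:
  obtains S Z where "transversal S" "transversal Z" "S \<inter> Z = {}"
proof -
  define r where "r = {(f, g). f \<in> E - bridges \<and> g \<in> E - bridges \<and> (f = g \<or> cocyclic f g)}"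
  have r: "equiv (E - bridges) r" unfolding r_def by (rule equiv_cocyclic)
  let ?Q = "(E - bridges) // r"
  have two: "\<exists>f g. f \<in> C \<and> g \<in> C \<and> f \<noteq> g" if C: "C \<in> ?Q" for C
  proof -
    obtain f where f: "f \<in> E - bridges" "C = r `` {f}" using C unfolding quotient_def by blast
    obtain g where g: "cocyclic g f" using ex_cocyclic f by blast
    have "cocyclic f g" using cocyclic_sym g f by blast
    then have "(f, g) \<in> r" "f \<noteq> g"
      using f g cocyclic_in_E[OF g] cocyclic_not_bridge[OF g] not_cocyclic_self by (auto simp: r_def)
    then show ?thesis using f by (auto simp: r_def)
  qed
  have tr: "transversal (h ` ?Q)" if h: "\<And>C. C \<in> ?Q \<Longrightarrow> h C \<in> C" for h
    unfolding transversal_def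
  proof (intro conjI ballI)
    show "h ` ?Q \<subseteq> E - bridges" using h in_quotient_imp_subset[OF r] by blast
    show "\<exists>s\<in>h ` ?Q. f = s \<or> cocyclic f s" if f: "f \<in> E - bridges" for f
    proof -
      have Q: "r `` {f} \<in> ?Q" using f by (rule quotientI)
      have "(f, h (r `` {f})) \<in> r" using h[OF Q] by blast
      then show ?thesis using Q by (auto simp: r_def)
    qed
  next
    fix s t assume st: "s \<in> h ` ?Q" "t \<in> h ` ?Q"
    then obtain C D where CD: "C \<in> ?Q" "D \<in> ?Q" "s = h C" "t = h D" by blast
    show "\<not> cocyclic s t"
    proof
      assume "cocyclic s t"
      moreover have "s \<in> E - bridges" "t \<in> E - bridges"
        using st h in_quotient_imp_subset[OF r] by blast+
      ultimately have "(h C, h D) \<in> r" using CD by (simp add: r_def)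
      then have "C = D" using quotient_eqI[OF r CD(1,2) h[OF CD(1)] h[OF CD(2)]] by simp
      then show False using \<open>cocyclic s t\<close> CD not_cocyclic_self by simp
    qed
  qed
  define p where "p C = (SOME f. f \<in> C)" for C :: "'a set set"
  define q where "q C = (SOME f. f \<in> C \<and> f \<noteq> p C)" for C :: "'a set set"
  have p: "p C \<in> C" if "C \<in> ?Q" for C
    unfolding p_def using two[OF that] by (metis someI)
  have q: "q C \<in> C \<and> q C \<noteq> p C" if "C \<in> ?Q" for C
    unfolding q_def using two[OF that] by (metis (mono_tags, lifting) someI)
  have "p ` ?Q \<inter> q ` ?Q = {}"
  proof (rule ccontr)
    assume "p ` ?Q \<inter> q ` ?Q \<noteq> {}"
    then obtain C D where CD: "C \<in> ?Q" "D \<in> ?Q" "p C = q D" by auto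
    then have "C \<inter> D \<noteq> {}" using p q by (metis disjoint_iff)
    then have "C = D" using quotient_disj[OF r CD(1,2)] by blast
    then show False using CD q by metis
  qed
  then show thesis using that[of "p ` ?Q" "q ` ?Q"] tr p q by blast
qed

text \<open>Another edge of \<open>S\<close> on a cycle through \<open>s\<close> would be cocyclic
  with \<open>s\<close>; so any path that bypasses \<open>s\<close> avoids all of
  \<open>S\<close>.\<close>

lemma transversal_cycle:
  assumes "transversal S" "s \<in> S"
  obtains x y D where "s = {x, y}" "upath (E - S) x D y"
proof -
  have s: "s \<in> E - bridges" using assms by (auto simp: transversal_def)
  then obtain x y where xy: "s = {x, y}" using edge_ends[of s] by blast
  then obtain D where D: "upath (E - {s}) x D y"
    using s joined_of_not_bridge[of x y] by (auto simp: joined_def)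
  have "t \<notin> path_edges D" if "t \<in> S" for t
    using that assms D xy unfolding transversal_def cocyclic_def by blast
  then have "upath (E - S) x D y" using D by (auto simp: upath_def)
  with that xy show thesis by blast
qed

text \<open>The edges of \<open>S\<close> can be bypassed independently, because no bypass uses an
  edge of \<open>S\<close>.\<close>

lemma transversal_joined:
  assumes "transversal S" "u \<in> V" "v \<in> V"
  shows "joined (E - S) u v"
proof -
  have edge: "joined (E - S) x y" if "{x, y} \<in> E" for x y
  proof (cases "{x, y} \<in> S")
    case True
    then obtain x' y' D where "{x, y} = {x', y'}" "upath (E - S) x' D y'"
      using transversal_cycle assms(1) by metis
    then have "joined (E - S) x' y'" "x = x' \<and> y = y' \<or> x = y' \<and> y = x'"
      by (auto simp: joined_def doubleton_eq_iff)
    then show ?thesis by (metis joined_sym)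
  next
    case False
    then show ?thesis using that by (simp add: joined_edge)
  qed
  show ?thesis using joined_subst[OF edge joined_all[OF assms(2,3)]] .
qed

text \<open>\<open>P\<close> is rerouted over the representative \<open>s\<close> of the class of
  \<open>f\<close>. Neither \<open>P\<close> nor the rest of the cycle through \<open>f\<close> and
  \<open>s\<close> contributes an edge of \<open>S\<close>.\<close>

lemma transversal_once:
  assumes S: "transversal S" and P: "upath (E - S) u P v" and f: "f \<in> path_edges P" "f \<notin> bridges"
  obtains Q s where "upath E u Q v" "path_edges Q \<inter> S = {s}"
proof -
  have fE: "f \<in> E" "f \<notin> S" using P f by (auto simp: upath_def)
  then obtain s where s: "s \<in> S" "cocyclic f s"
    using S f unfolding transversal_def by (metis DiffI)
  then obtain x y D where D: "s = {x, y}" "upath (E - {s}) x D y" "f \<in> path_edges D"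
    by (auto simp: cocyclic_def)
  have "t \<notin> path_edges D" if "t \<in> S" for t
    using that s S D unfolding transversal_def cocyclic_def by blast
  then have DS: "path_edges D \<inter> S = {}" by blast
  have "upath E u P v" "upath E x D y" using P D by (auto simp: upath_def)
  moreover have "card f = 2" using card_edge fE by blast
  moreover have "{x, y} \<in> E" using S s D by (auto simp: transversal_def)
  ultimately obtain Q where Q: "upath E u Q v" "{x, y} \<in> path_edges Q"
      "path_edges Q \<subseteq> insert {x, y} (path_edges P \<union> path_edges D)"
    using upath_via_cycle_edge f(1) D(3) by metis
  have "path_edges Q \<inter> S = {s}" using Q DS P s D(1) by (auto simp: upath_def)
  with that Q show thesis by blast
qed

text \<open>Otherwise the two parts of \<open>P\<close> beside \<open>e\<close>, together with
  \<open>Q\<close>, would join the ends of \<open>e\<close> without \<open>e\<close>.\<close>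

lemma bridges_on_paths:
  assumes P: "upath E u P v" and Q: "upath E u Q v" and e: "e \<in> path_edges P" "e \<in> bridges"
  shows "e \<in> path_edges Q"
proof (rule ccontr)
  assume eQ: "e \<notin> path_edges Q"
  obtain ys zs where yz: "P = ys @ zs" "ys \<noteq> []" "zs \<noteq> []" "e = {last ys, hd zs}"
    using path_edges_split[OF e(1)] .
  note D = upath_appendD[OF P[unfolded yz(1)] yz(2,3)]
  have "last ys \<in> set ys" "hd zs \<in> set zs" using yz by auto
  then have "e \<notin> path_edges ys" "e \<notin> path_edges zs"
    using path_edges_subset D(4) yz(4) by blast+
  then have "joined (E - {e}) u (last ys)" "joined (E - {e}) (hd zs) v"
    using D by (auto simp: joined_def upath_def)
  moreover have "joined (E - {e}) u v" using Q eQ by (auto simp: joined_def upath_def)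
  ultimately have "joined (E - {e}) (last ys) (hd zs)"
    using joined_sym joined_trans by metis
  then show False using not_bridge_of_joined[of "last ys" "hd zs"] e(2) yz(4) by simp
qed

end

section \<open>Vertex-colorings of graphs of diameter 4\<close>

text \<open>For vertices other than \<open>a\<close>, this means lying in the same component after
  the deletion of \<open>a\<close>.\<close>

definition linked :: "'a set set \<Rightarrow> 'a \<Rightarrow> 'a \<Rightarrow> 'a \<Rightarrow> bool" where
  "linked E a x y \<longleftrightarrow> (\<exists>xs. upath E x xs y \<and> a \<notin> set xs)"

lemma separates_iff_not_linked: "separates E a x y \<longleftrightarrow> x \<noteq> a \<and> y \<noteq> a \<and> \<not> linked E a x y"
  by (auto simp: separates_def linked_def)

lemma linked_sym: "linked E a x y \<Longrightarrow> linked E a y x"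
  unfolding linked_def by (metis upath_rev set_rev)

lemma linked_trans:
  assumes "linked E a x y" "linked E a y z"
  shows "linked E a x z"
proof -
  obtain xs ys where "upath E x xs y" "a \<notin> set xs" "upath E y ys z" "a \<notin> set ys"
    using assms by (auto simp: linked_def)
  moreover from this obtain as w bs cs ds where "xs = as @ w # bs" "ys = cs @ w # ds"
    "upath E x (as @ w # ds) z"
    using upath_concat by metis
  ultimately show ?thesis by (auto simp: linked_def)
qed

lemma linked_prefix:
  assumes "upath E x (xs @ y # ys) z" "a \<notin> set xs" "a \<noteq> y"
  shows "linked E a x y"
  unfolding linked_def using assms upath_splitD(1)[OF assms(1)]
  by (intro exI[of _ "xs @ [y]"]) auto

section \<open>Cut vertices and the center\<close>

context connected_graph
begin

definition cut_vertex :: "'a \<Rightarrow> bool" where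
  "cut_vertex a \<longleftrightarrow> (\<exists>x\<in>V. \<exists>y\<in>V. separates E a x y)"

text \<open>Of two vertices on different sides of \<open>a\<close>, at least one is not on the side
  of \<open>c\<close>.\<close>

lemma cut_vertex_separates:
  assumes "cut_vertex a" "c \<in> V" "c \<noteq> a"
  shows "\<exists>x\<in>V. separates E a x c"
proof -
  obtain x y where xy: "x \<in> V" "y \<in> V" "separates E a x y"
    using assms by (auto simp: cut_vertex_def)
  then have "\<not> (linked E a x c \<and> linked E a c y)"
    using linked_trans by (metis separates_iff_not_linked)
  then show ?thesis using xy assms linked_sym by (metis separates_iff_not_linked)
qed

text \<open>A path from \<open>x\<close> to \<open>c\<close> passes \<open>a\<close> before it ends
  in \<open>c\<close>; the part up to \<open>a\<close> avoids \<open>c\<close>.\<close>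

lemma linked_of_separates:
  assumes "separates E a x c" "x \<in> V" "c \<in> V"
  shows "linked E c x a" "a \<in> V"
proof -
  obtain P where P: "upath E x P c" using joined_all assms by (auto simp: joined_def)
  then have "a \<in> set P" using assms by (simp add: separates_def)
  then show "a \<in> V" using upath_in_V P assms by blast
  obtain A B where AB: "P = A @ a # B" using \<open>a \<in> set P\<close> by (meson split_list)
  have "c \<noteq> a" using assms by (simp add: separates_def)
  moreover from this have "c \<in> set B" using P AB by (auto simp: upath_def split: if_splits)
  then have "c \<notin> set A" using P AB by (auto simp: upath_def)
  ultimately show "linked E c x a" using linked_prefix P AB by metis
qed

text \<open>
  Take the middle one of three cut vertices \<open>c\<^sub>1\<close>, \<open>c\<^sub>2\<close>, \<open>c\<^sub>3\<close> with \<open>c\<^sub>2\<close> separating \<open>c\<^sub>1\<close> from \<open>c\<^sub>3\<close>,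
  if there are such, and any cut vertex otherwise.
\<close>

lemma ex_center:
  assumes diam: "\<And>u v. \<lbrakk>u \<in> V; v \<in> V\<rbrakk> \<Longrightarrow> \<exists>P. upath E u P v \<and> length P \<le> 5" and "V \<noteq> {}"
  obtains c where "c \<in> V"
    "\<And>a a' x. \<lbrakk>a' \<in> V; x \<in> V; separates E a a' c\<rbrakk> \<Longrightarrow> \<not> separates E a' x c"
proof (cases "\<exists>c1\<in>V. \<exists>c2\<in>V. \<exists>c3\<in>V. cut_vertex c1 \<and> cut_vertex c3 \<and> separates E c2 c1 c3")
  case True
  then obtain c1 c2 c3 where c: "c1 \<in> V" "c2 \<in> V" "c3 \<in> V" "cut_vertex c1" "cut_vertex c3"
    "separates E c2 c1 c3"
    by blast
  have c12: "c1 \<noteq> c2" "c3 \<noteq> c2" using c by (auto simp: separates_def)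
  \<comment> \<open>Seen from \<open>c2\<close>, the vertices \<open>x1\<close> and
    \<open>x3\<close> lie behind \<open>c1\<close> and \<open>c3\<close>, and thus on different
    sides of \<open>c2\<close>.\<close>
  obtain x1 where x1: "x1 \<in> V" "separates E c1 x1 c2" using cut_vertex_separates[of c1 c2] c c12 by auto
  obtain x3 where x3: "x3 \<in> V" "separates E c3 x3 c2" using cut_vertex_separates[of c3 c2] c c12 by auto
  have l1: "linked E c2 c1 x1" using linked_of_separates x1 c linked_sym by metis
  have l3: "linked E c2 x3 c3" using linked_of_separates x3 c by metis
  show thesis
  proof (rule that[of c2])
    fix a a' x
    assume a: "a' \<in> V" "x \<in> V" "separates E a a' c2"
    show "\<not> separates E a' x c2"
    proof
      assume a': "separates E a' x c2"
      \<comment> \<open>So \<open>x\<close> is not on the side of both \<open>x1\<close> and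
        \<open>x3\<close>. Take the one on another side as \<open>w\<close>, with its cut vertex as
        \<open>d\<close>.\<close>
      have "\<not> (linked E c2 x1 x \<and> linked E c2 x3 x)"
        using l1 l3 c(6) linked_trans linked_sym by (metis separates_iff_not_linked)
      then obtain w d where w: "w \<in> V" "separates E d w c2" "\<not> linked E c2 w x"
        using x1 x3 by blast
      \<comment> \<open>\<open>P\<close> has to pass \<open>w\<close>, \<open>d\<close>,
        \<open>c2\<close>, \<open>a\<close>, \<open>a'\<close> and \<open>x\<close> in this order,
        which are six vertices.\<close>
      obtain P where P: "upath E w P x" "length P \<le> 5" using diam a w by blast
      then have dP: "distinct P" by (simp add: upath_def)
      have "c2 \<in> set P" using w P by (auto simp: linked_def)
      then obtain A B where AB: "P = A @ c2 # B" by (meson split_list)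
      note Ps = upath_splitD[OF P(1)[unfolded AB]]
      have "d \<in> set A" using w(2) Ps(1) unfolding separates_def by force
      moreover have "w \<in> set A" using Ps(1) w(2) by (cases A) (auto simp: upath_def separates_def)
      moreover have "w \<noteq> d" using w(2) by (simp add: separates_def)
      moreover have "card (set A) \<le> length A" by (rule card_length)
      moreover have "card {w, d} = 2" using \<open>w \<noteq> d\<close> by simp
      ultimately have A: "2 \<le> length A" by (metis card_mono empty_subsetI insert_subset le_trans List.finite_set)
      have "a' \<in> set (c2 # B)" using separates_sym[OF a'] Ps(2) unfolding separates_def by blast
      then have "a' \<in> set B" using a' by (auto simp: separates_def)
      then obtain B1 B2 where B: "B = B1 @ a' # B2" by (meson split_list)
      have "upath E c2 ((c2 # B1) @ a' # B2) x" using Ps(2) B by simp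
      from upath_splitD(1)[OF this] have "a \<in> set ((c2 # B1) @ [a'])"
        using separates_sym[OF a(3)] unfolding separates_def by blast
      then have B1: "B1 \<noteq> []" using a(3) by (auto simp: separates_def)
      have "last (c2 # B) = x" using Ps(2) by (simp add: upath_def)
      then have "B2 \<noteq> []" using B a' by (auto simp: separates_def)
      then show False using A B B1 AB P(2) by (cases B1; cases B2) auto
    qed
  qed (use c in auto)
next
  case False
  obtain c where c: "c \<in> V" "(\<exists>c\<in>V. cut_vertex c) \<longrightarrow> cut_vertex c" using \<open>V \<noteq> {}\<close> by blast
  show thesis
  proof (rule that[OF c(1)], rule notI)
    fix a a' x
    assume a: "a' \<in> V" "x \<in> V" "separates E a a' c" "separates E a' x c"
    \<comment> \<open>Both \<open>a'\<close> and \<open>c\<close> are now cut vertices, and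
      \<open>a\<close> separates them: the configuration excluded in this case.\<close>
    then have "cut_vertex a'" "a \<in> V" using c linked_of_separates by (auto simp: cut_vertex_def)
    moreover from this have "cut_vertex c" using a c by blast
    ultimately show False using False a c by blast
  qed
qed

lemma ex_conflict_free_vertex_coloring:
  assumes c: "c \<in> V"
    and center: "\<And>a a' x. \<lbrakk>a' \<in> V; x \<in> V; separates E a a' c\<rbrakk> \<Longrightarrow> \<not> separates E a' x c"
  defines "f \<equiv> \<lambda>v. if v = c then 2 else if cut_vertex v then 1 else 0 :: nat"
  assumes uv: "u \<in> V" "v \<in> V" "u \<noteq> v"
  shows "\<exists>P. upath E u P v \<and> (\<exists>k. card {x \<in> set P. f x = k} = 1)"
proof -
  \<comment> \<open>\<open>y\<close> is on the side of \<open>w\<close>, so \<open>a\<close>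
    separates it from \<open>c\<close>. If \<open>y\<close> were a cut vertex, it would separate a
    further vertex from \<open>c\<close>, against the choice of the center.\<close>
  have low: "y \<noteq> c \<and> \<not> cut_vertex y" if "separates E a w c" "y \<in> V" "linked E a w y" for a w y
  proof
    show "y \<noteq> c" using that by (auto simp: separates_iff_not_linked)
    have "\<not> linked E a y c" using that linked_trans by (metis separates_iff_not_linked)
    moreover have "y \<noteq> a" "c \<noteq> a" using that by (auto simp: separates_def linked_def upath_def)
    ultimately have "separates E a y c" by (simp add: separates_iff_not_linked)
    then show "\<not> cut_vertex y"
      using center that(2) cut_vertex_separates[of y c] c \<open>y \<noteq> c\<close> by blast
  qed
  have side: "\<forall>y\<in>set X. f y = 0" if "w = a \<or> separates E a w c" "w \<in> V" "upath E w (X @ a # Y) z" for w a X Y z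
  proof
    fix y assume y: "y \<in> set X"
    then obtain X1 X2 where X: "X = X1 @ y # X2" by (meson split_list)
    have "a \<notin> set X" using that(3) by (auto simp: upath_def)
    then have "a \<notin> set X1" "a \<noteq> y" using X by auto
    then have l: "linked E a w y" using linked_prefix[of E w X1 y "X2 @ a # Y" z a] that(3) X by simp
    then have "w \<noteq> a" by (auto simp: linked_def upath_def)
    moreover have "y \<in> V" using upath_in_V[OF that(3,2)] y by auto
    ultimately show "f y = 0" using low[of a w y] that l by (auto simp: f_def)
  qed
  show ?thesis
  proof (cases "\<exists>P. upath E u P v \<and> c \<in> set P")
    case True
    then obtain P where P: "upath E u P v" "c \<in> set P" by blast
    then have "{x \<in> set P. f x = 2} = {c}" by (auto simp: f_def split: if_splits)
    then show ?thesis using P by (metis card_1_singleton_iff One_nat_def)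
  next
    case False
    then obtain a where a: "a \<noteq> c" "u = a \<or> separates E a u c" "v = a \<or> separates E a v c"
      using ex_separator_of_no_path_through[OF uv(1,2) c] by blast
    then have "cut_vertex a" "a \<in> V"
      using uv c linked_of_separates(2) by (auto simp: cut_vertex_def)
    \<comment> \<open>Otherwise the separator argument, now with \<open>a\<close> in the role of
      \<open>c\<close>, gives a cut vertex \<open>b\<close> behind \<open>a\<close>, which
      \<open>low\<close> forbids.\<close>
    have "\<exists>P. upath E u P v \<and> a \<in> set P"
    proof (rule ccontr)
      assume no: "\<nexists>P. upath E u P v \<and> a \<in> set P"
      then obtain b where b: "b \<noteq> a" "u = b \<or> separates E b u a" "v = b \<or> separates E b v a"
        using ex_separator_of_no_path_through[OF uv(1,2) \<open>a \<in> V\<close>] by blast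
      obtain P where "upath E u P v" using joined_all uv by (auto simp: joined_def)
      then have "u \<noteq> a" "v \<noteq> a" using no by (auto simp: upath_def)
      then obtain w where w: "w \<in> V" "separates E b w a" "separates E a w c"
        using a b uv by blast
      then have "linked E a w b" "b \<in> V" using linked_of_separates \<open>a \<in> V\<close> by auto
      then show False using low[OF w(3)] w \<open>a \<in> V\<close> by (auto simp: cut_vertex_def)
    qed
    then obtain P X Y where P: "upath E u P v" "P = X @ a # Y" by (meson split_list)
    have "\<forall>y\<in>set X. f y = 0" using side a uv P by blast
    moreover have "\<forall>y\<in>set (rev Y). f y = 0"
      using side[of v a "rev Y" "rev X" u] a uv upath_rev[OF P(1)] P(2) by simp
    moreover have "f a = 1" using a \<open>cut_vertex a\<close> by (simp add: f_def)
    ultimately have "{x \<in> set P. f x = 1} = {a}" using P(2) by auto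
    then show ?thesis using P(1) by (metis card_1_singleton_iff One_nat_def)
  qed
qed

end

section \<open>Edge-colorings\<close>

context connected_graph
begin

lemma bridges_subset: "bridges \<subseteq> E"
  by (auto simp: bridges_def)

lemma path_bridges_eq:
  assumes "upath E u P v" "upath E u Q v"
  shows "path_edges P \<inter> bridges = path_edges Q \<inter> bridges"
  using bridges_on_paths[OF assms] bridges_on_paths[OF assms(2,1)] by blast

text \<open>The path \<open>A\<close> exists because deleting \<open>S\<close> keeps the graph
  connected. It contains a non-bridge, since otherwise its edges would be just the bridges on
  \<open>P\<close>, fewer than the edges of the shortest path \<open>P\<close>. So \<open>A\<close>
  can be rerouted over one edge of \<open>S\<close>.\<close>

lemma paths_meeting_transversal:
  assumes P: "upath E u P v" "\<And>Q. upath E u Q v \<Longrightarrow> length P \<le> length Q"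
    and f: "f \<in> path_edges P" "f \<notin> bridges" and S: "transversal S" and V: "u \<in> V" "v \<in> V"
  obtains A Q s where "upath E u A v" "path_edges A \<inter> S = {}"
    "upath E u Q v" "path_edges Q \<inter> S = {s}"
proof -
  obtain A where A: "upath (E - S) u A v" using transversal_joined[OF S V] by (auto simp: joined_def)
  then have AE: "upath E u A v" "path_edges A \<inter> S = {}" by (auto simp: upath_def)
  have "\<exists>g\<in>path_edges A. g \<notin> bridges"
  proof (rule ccontr)
    assume "\<not> ?thesis"
    then have "path_edges A \<subset> path_edges P" using path_bridges_eq[OF AE(1) P(1)] f by blast
    then have "card (path_edges A) < card (path_edges P)" by (simp add: psubset_card_mono)
    then have "length A - 1 < length P - 1"
      using AE(1) P(1) card_path_edges unfolding upath_def by metis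
    then show False using P(2)[OF AE(1)] by simp
  qed
  then obtain g where "g \<in> path_edges A" "g \<notin> bridges" by blast
  with transversal_once[OF S A] that AE show thesis by metis
qed

text \<open>
  With \<open>m\<^sub>0\<close> and \<open>m\<^sub>1\<close> bridges of color 0 and 1 on the paths from \<open>u\<close> to \<open>v\<close>, color 0 can be made to
  occur \<open>m\<^sub>0\<close> or \<open>m\<^sub>0 + 1\<close> times and color 1 can be made to occur \<open>m\<^sub>1\<close> or \<open>m\<^sub>1 + 1\<close> times. So a
  failure needs \<open>m\<^sub>0, m\<^sub>1 \<ge> 2\<close>, that is, four bridges on a path of at most four edges.
\<close>

lemma conflict_free_via_transversals:
  assumes P: "upath E u P v" "\<And>Q. upath E u Q v \<Longrightarrow> length P \<le> length Q" "length P \<le> 5"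
    and f: "f \<in> path_edges P" "f \<notin> bridges" and V: "u \<in> V" "v \<in> V"
    and S: "transversal S" and Z: "transversal Z" and SZ: "S \<inter> Z = {}"
    and c: "\<And>e. e \<in> E \<Longrightarrow> c e = (if e \<in> S then 0 else if e \<in> Z then 1 else if e \<notin> bridges then 2 else d e)"
  shows "\<exists>Q. upath E u Q v \<and> (\<exists>k::nat. card {e \<in> path_edges Q. c e = k} = 1)"
proof -
  \<comment> \<open>All paths from \<open>u\<close> to \<open>v\<close> have these bridges, so the
    numbers \<open>m k\<close> do not depend on the path.\<close>
  define B where "B = path_edges P \<inter> bridges"
  define m where "m k = card {e \<in> B. d e = k}" for k
  have SB: "S \<inter> bridges = {}" "Z \<inter> bridges = {}" using S Z by (auto simp: transversal_def)
  have count: "card {e \<in> path_edges Q. c e = k} = card (path_edges Q \<inter> T) + m k"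
    if Q: "upath E u Q v" and T: "T = S \<and> k = 0 \<or> T = Z \<and> k = 1" for Q T k
  proof -
    have B: "B = path_edges Q \<inter> bridges" using path_bridges_eq[OF P(1) Q] by (simp add: B_def)
    have QE: "path_edges Q \<subseteq> E" using Q by (simp add: upath_def)
    have "{e \<in> path_edges Q. c e = k} = (path_edges Q \<inter> T) \<union> {e \<in> B. d e = k}"
    proof -
      have "c e = k \<longleftrightarrow> e \<in> T \<or> e \<in> B \<and> d e = k" if "e \<in> path_edges Q" for e
      proof -
        have "e \<in> E" "e \<in> B \<longleftrightarrow> e \<in> bridges" using that QE B by auto
        moreover have "e \<in> S \<Longrightarrow> e \<notin> Z \<and> e \<notin> bridges" "e \<in> Z \<Longrightarrow> e \<notin> bridges" using SB SZ by auto
        ultimately show ?thesis using T c[of e] by (cases "e \<in> S"; cases "e \<in> Z"; cases "e \<in> bridges") auto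
      qed
      then show ?thesis using B by auto
    qed
    moreover have "T \<inter> B = {}" using SB T B by auto
    ultimately show ?thesis
      unfolding m_def using B by (subst card_Un_disjoint[symmetric]) auto
  qed
  obtain A Q s where S': "upath E u A v" "path_edges A \<inter> S = {}" "upath E u Q v" "path_edges Q \<inter> S = {s}"
    using paths_meeting_transversal[OF P(1,2) f S V] .
  obtain A' Q' s' where Z': "upath E u A' v" "path_edges A' \<inter> Z = {}" "upath E u Q' v" "path_edges Q' \<inter> Z = {s'}"
    using paths_meeting_transversal[OF P(1,2) f Z V] .
  note counts = count[OF S'(1), of S 0] count[OF S'(3), of S 0] count[OF Z'(1), of Z 1] count[OF Z'(3), of Z 1]
  show ?thesis
  proof (cases "m 0 \<le> 1 \<or> m 1 \<le> 1")
    case True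
    then consider "m 0 = 0" | "m 0 = 1" | "m 1 = 0" | "m 1 = 1" by linarith
    then show ?thesis
    proof cases
      case 1
      then have "card {e \<in> path_edges Q. c e = 0} = 1" using counts(2) S'(4) by simp
      then show ?thesis using S'(3) by blast
    next
      case 2
      then have "card {e \<in> path_edges A. c e = 0} = 1" using counts(1) S'(2) by simp
      then show ?thesis using S'(1) by blast
    next
      case 3
      then have "card {e \<in> path_edges Q'. c e = 1} = 1" using counts(4) Z'(4) by simp
      then show ?thesis using Z'(3) by blast
    next
      case 4
      then have "card {e \<in> path_edges A'. c e = 1} = 1" using counts(3) Z'(2) by simp
      then show ?thesis using Z'(1) by blast
    qed
  next
    case False
    have fin: "finite B" by (simp add: B_def)
    \<comment> \<open>The non-bridge \<open>f\<close> leaves at most three of the at most four edges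
      of \<open>P\<close> for bridges.\<close>
    have psub: "B \<subset> path_edges P" using f unfolding B_def by blast
    have "{e \<in> B. d e = 0} \<inter> {e \<in> B. d e = 1} = {}" by auto
    then have "m 0 + m 1 = card ({e \<in> B. d e = 0} \<union> {e \<in> B. d e = 1})"
      unfolding m_def using fin by (simp add: card_Un_disjoint)
    also have "\<dots> \<le> card B" by (rule card_mono[OF fin]) blast
    also have "\<dots> < card (path_edges P)"
      using psubset_card_mono[OF finite_path_edges psub] .
    also have "\<dots> \<le> 4" using P(1,3) card_path_edges[of P] by (simp add: upath_def)
    finally show ?thesis using False by simp
  qed
qed

lemma conflict_free_via_transversal:
  assumes P: "upath E u P v" "\<And>Q. upath E u Q v \<Longrightarrow> length P \<le> length Q"
    and f: "f \<in> path_edges P" "f \<notin> bridges" and V: "u \<in> V" "v \<in> V" and S: "transversal S"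
  shows "\<exists>Q. upath E u Q v \<and> (\<exists>k::nat. card {e \<in> path_edges Q. (if e \<in> S then 1 else 0) = k} = 1)"
proof -
  obtain A Q s where Q: "upath E u A v" "path_edges A \<inter> S = {}" "upath E u Q v" "path_edges Q \<inter> S = {s}"
    using paths_meeting_transversal[OF P(1,2) f S V] .
  have "{e \<in> path_edges Q. (if e \<in> S then 1 else 0) = (1::nat)} = {s}" using Q(4) by auto
  then have "card {e \<in> path_edges Q. (if e \<in> S then 1 else 0) = (1::nat)} = 1"
    by (simp only: card_1_singleton_iff One_nat_def) blast
  then show ?thesis using Q(3) by (intro exI[of _ Q] exI[of _ "1::nat"] conjI)
qed

lemma ex_shortest_upath:
  assumes "u \<in> V" "v \<in> V"
  obtains P where "upath E u P v" "\<forall>Q. upath E u Q v \<longrightarrow> length P \<le> length Q"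
proof -
  obtain P0 where "upath E u P0 v" using joined_all assms by (auto simp: joined_def)
  from ex_has_least_nat[of "\<lambda>P. upath E u P v", OF this, of length] that show thesis by blast
qed

text \<open>\<open>Q\<close> has all edges of \<open>P\<close>. If it had a further edge
  \<open>f\<close>, deleting \<open>f\<close> would split \<open>Q\<close> into two vertex-disjoint
  parts, and \<open>P\<close>, using only edges within these parts, could not get from
  \<open>u\<close> to \<open>v\<close>.\<close>

lemma bridge_path_unique:
  assumes P: "upath E u P v" "path_edges P \<subseteq> bridges" and Q: "upath E u Q v"
  shows "path_edges Q = path_edges P"
proof (rule ccontr)
  assume "path_edges Q \<noteq> path_edges P"
  moreover have sub: "path_edges P \<subseteq> path_edges Q" using path_bridges_eq[OF P(1) Q] P(2) by blast
  ultimately obtain f where f: "f \<in> path_edges Q" "f \<notin> path_edges P" by blast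
  obtain ys zs where yz: "Q = ys @ zs" "ys \<noteq> []" "zs \<noteq> []" "f = {last ys, hd zs}"
    using path_edges_split[OF f(1)] .
  have d: "set ys \<inter> set zs = {}" using Q yz by (auto simp: upath_def)
  have stay: "set xs \<subseteq> set ys" if "path_edges xs \<subseteq> path_edges ys \<union> path_edges zs" "xs \<noteq> []" "hd xs \<in> set ys" for xs
    using that
  proof (induction xs)
    case (Cons x xs)
    show ?case
    proof (cases "xs = []")
      case False
      then have "{x, hd xs} \<in> path_edges ys \<union> path_edges zs" using Cons.prems by (auto simp: path_edges_Cons)
      then have "{x, hd xs} \<subseteq> set ys \<or> {x, hd xs} \<subseteq> set zs" using path_edges_subset by blast
      then have "hd xs \<in> set ys" using Cons.prems(3) d by auto
      then show ?thesis using Cons False by (auto simp: path_edges_Cons)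
    qed (use Cons.prems in auto)
  qed simp
  have "path_edges P \<subseteq> path_edges ys \<union> path_edges zs"
    using sub f yz by (auto simp: path_edges_append)
  moreover have "P \<noteq> []" "hd P \<in> set ys" using P Q yz by (auto simp: upath_def)
  ultimately have "last P \<in> set ys" using stay by (meson last_in_set subsetD)
  moreover have "last P \<in> set zs" using P Q yz by (auto simp: upath_def)
  ultimately show False using d by blast
qed

end

section \<open>Paths in symmetric digraphs\<close>

lemma edges_delete_edge: "edges (delete_edge G e) = edges G - {e}"
  by (auto simp: edges_def delete_edge_def edge_of_def)

context sym_digraph
begin

lemma edge_arc:
  assumes "{u, v} \<in> edges G"
  obtains a where "a \<in> arcs G" "tail G a = u" "head G a = v"
proof -
  obtain b where b: "b \<in> arcs G" "{u, v} = {tail G b, head G b}"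
    using assms by (auto simp: edges_def edge_of_def)
  obtain b' where "b' \<in> arcs G" "tail G b = head G b'" "head G b = tail G b'"
    using sym_arcs b(1) unfolding symmetric_conv by blast
  then show thesis using b that[of b] that[of b'] by (auto simp: doubleton_eq_iff)
qed

lemma apath_of_upath:
  assumes "upath (edges G) u xs v" "u \<in> verts G"
  obtains p where "apath u p v" "awalk_verts u p = xs" "edge_of G ` set p = path_edges xs"
proof -
  have "\<exists>p. apath u p v \<and> awalk_verts u p = xs \<and> edge_of G ` set p = path_edges xs"
    using assms
  proof (induction xs arbitrary: u)
    case (Cons x xs)
    show ?case
    proof (cases "xs = []")
      case True
      then show ?thesis using Cons.prems by (intro exI[of _ "[]"]) (auto simp: upath_def apath_Nil_iff)
    next
      case False
      then have xs: "upath (edges G) (hd xs) xs v" "{x, hd xs} \<in> edges G" "x = u" "u \<notin> set xs"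
        using Cons.prems by (auto simp: upath_def path_edges_Cons)
      obtain a where a: "a \<in> arcs G" "tail G a = u" "head G a = hd xs"
        using edge_arc xs by metis
      then have "hd xs \<in> verts G" using head_in_verts by metis
      then obtain p where p: "apath (hd xs) p v" "awalk_verts (hd xs) p = xs" "edge_of G ` set p = path_edges xs"
        using Cons.IH[OF xs(1)] by blast
      have "apath u (a # p) v" using a p xs by (simp add: apath_Cons_iff)
      moreover have "awalk_verts u (a # p) = x # xs" using a p xs by simp
      moreover have "edge_of G ` set (a # p) = path_edges (x # xs)"
        using a p xs False by (simp add: path_edges_Cons edge_of_def)
      ultimately show ?thesis by blast
    qed
  qed (simp add: upath_def)
  then show thesis using that by blast
qed

end

context wf_digraph
begin

lemma path_edges_awalk_verts:
  "cas u p v \<Longrightarrow> path_edges (awalk_verts u p) = edge_of G ` set p"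
proof (induction p arbitrary: u)
  case (Cons a p)
  then have "cas (head G a) p v" "tail G a = u" by auto
  then have "hd (awalk_verts (head G a) p) = head G a" using awhd_if_cas by blast
  then show ?case using Cons by (auto simp: path_edges_Cons edge_of_def)
qed simp

lemma upath_of_apath:
  assumes "apath u p v"
  shows "upath (edges G) u (awalk_verts u p) v" "path_edges (awalk_verts u p) = edge_of G ` set p"
proof -
  have p: "cas u p v" "set p \<subseteq> arcs G" "distinct (awalk_verts u p)"
    using assms by (auto simp: apath_def awalk_def)
  then show e: "path_edges (awalk_verts u p) = edge_of G ` set p"
    using path_edges_awalk_verts by blast
  show "upath (edges G) u (awalk_verts u p) v"
    using p e awhd_if_cas awlast_if_cas unfolding upath_def edges_def by auto
qed

end

section \<open>Connectedness and colorings in terms of vertex lists\<close>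

context sym_digraph
begin

lemma reachable_iff_joined:
  assumes "u \<in> verts G"
  shows "u \<rightarrow>\<^sup>* v \<longleftrightarrow> joined (edges G) u v"
  unfolding reachable_apath joined_def using upath_of_apath(1) apath_of_upath assms by metis

lemma connected_iff_joined:
  "connected G \<longleftrightarrow> verts G \<noteq> {} \<and> (\<forall>u\<in>verts G. \<forall>v\<in>verts G. joined (edges G) u v)"
  unfolding connected_def strongly_connected_def
  using reachable_mk_symmetric_eq[OF sym_arcs] reachable_iff_joined by simp

lemma conflict_free_connected_iff:
  "conflict_free_connected G c \<longleftrightarrow> (\<forall>u\<in>verts G. \<forall>v\<in>verts G. u \<noteq> v \<longrightarrow>
     (\<exists>P. upath (edges G) u P v \<and> (\<exists>k. card {e \<in> path_edges P. c e = k} = 1)))"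
proof -
  have "(\<exists>p. apath u p v \<and> conflict_free_path G c p) \<longleftrightarrow>
      (\<exists>P. upath (edges G) u P v \<and> (\<exists>k. card {e \<in> path_edges P. c e = k} = 1))"
    if u: "u \<in> verts G" for u v
  proof
    assume "\<exists>p. apath u p v \<and> conflict_free_path G c p"
    then obtain p where "apath u p v" "\<exists>k. card {e \<in> edge_of G ` set p. c e = k} = 1"
      by (auto simp: conflict_free_path_def)
    then show "\<exists>P. upath (edges G) u P v \<and> (\<exists>k. card {e \<in> path_edges P. c e = k} = 1)"
      using upath_of_apath[of u p v] by (intro exI[of _ "awalk_verts u p"]) simp
  next
    assume "\<exists>P. upath (edges G) u P v \<and> (\<exists>k. card {e \<in> path_edges P. c e = k} = 1)"
    then obtain P where P: "upath (edges G) u P v" "\<exists>k. card {e \<in> path_edges P. c e = k} = 1"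
      by blast
    obtain p where "apath u p v" "awalk_verts u p = P" "edge_of G ` set p = path_edges P"
      using apath_of_upath[OF P(1) u] .
    then show "\<exists>p. apath u p v \<and> conflict_free_path G c p"
      using P(2) by (intro exI[of _ p]) (simp add: conflict_free_path_def)
  qed
  then show ?thesis unfolding conflict_free_connected_def by simp
qed

lemma conflict_free_vertex_connected_iff:
  "conflict_free_vertex_connected G c \<longleftrightarrow> (\<forall>u\<in>verts G. \<forall>v\<in>verts G. u \<noteq> v \<longrightarrow>
     (\<exists>P. upath (edges G) u P v \<and> (\<exists>k. card {x \<in> set P. c x = k} = 1)))"
proof -
  have "(\<exists>p. apath u p v \<and> conflict_free_vertex_path G c u p) \<longleftrightarrow>
      (\<exists>P. upath (edges G) u P v \<and> (\<exists>k. card {x \<in> set P. c x = k} = 1))"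
    if u: "u \<in> verts G" for u v
  proof
    assume "\<exists>p. apath u p v \<and> conflict_free_vertex_path G c u p"
    then obtain p where "apath u p v" "\<exists>k. card {x \<in> set (awalk_verts u p). c x = k} = 1"
      by (auto simp: conflict_free_vertex_path_def)
    then show "\<exists>P. upath (edges G) u P v \<and> (\<exists>k. card {x \<in> set P. c x = k} = 1)"
      using upath_of_apath(1)[of u p v] by (intro exI[of _ "awalk_verts u p"]) simp
  next
    assume "\<exists>P. upath (edges G) u P v \<and> (\<exists>k. card {x \<in> set P. c x = k} = 1)"
    then obtain P where P: "upath (edges G) u P v" "\<exists>k. card {x \<in> set P. c x = k} = 1"
      by blast
    obtain p where "apath u p v" "awalk_verts u p = P" "edge_of G ` set p = path_edges P"
      using apath_of_upath[OF P(1) u] .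
    then show "\<exists>p. apath u p v \<and> conflict_free_vertex_path G c u p"
      using P(2) by (intro exI[of _ p]) (simp add: conflict_free_vertex_path_def)
  qed
  then show ?thesis unfolding conflict_free_vertex_connected_def by simp
qed

text \<open>An injective coloring is conflict-free, so the \<open>LEAST\<close> in
  \<open>cfc\<close> ranges over a nonempty set and is attained.\<close>

lemma ex_cfc_coloring:
  assumes fin: "finite (edges G)"
    and joined: "\<And>u v. \<lbrakk>u \<in> verts G; v \<in> verts G\<rbrakk> \<Longrightarrow> joined (edges G) u v"
  obtains c :: "'a set \<Rightarrow> nat" where "card (c ` edges G) = cfc G" "conflict_free_connected G c"
proof -
  obtain c :: "'a set \<Rightarrow> nat" where c: "inj_on c (edges G)"
    using finite_imp_inj_to_nat_seg[OF fin] by blast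
  have "conflict_free_connected G c"
    unfolding conflict_free_connected_iff
  proof (intro ballI impI)
    fix u v assume uv: "u \<in> verts G" "v \<in> verts G" "u \<noteq> v"
    then obtain P where P: "upath (edges G) u P v" using joined by (auto simp: joined_def)
    then have "path_edges P \<noteq> {}"
      using uv(3) by (cases P rule: path_edges.cases) (auto simp: upath_def)
    then obtain e where e: "e \<in> path_edges P" by blast
    then have "{f \<in> path_edges P. c f = c e} = {e}"
      using c P by (auto simp: upath_def inj_on_def)
    then have "card {f \<in> path_edges P. c f = c e} = 1" by simp
    then show "\<exists>P. upath (edges G) u P v \<and> (\<exists>k. card {e \<in> path_edges P. c e = k} = 1)"
      using P by blast
  qed
  then have "\<exists>k. \<exists>c :: 'a set \<Rightarrow> nat. card (c ` edges G) = k \<and> conflict_free_connected G c" by blast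
  from LeastI_ex[OF this] show thesis using that unfolding cfc_def by blast
qed

text \<open>The colors of an optimal coloring are renamed injectively. A fixed palette lets
  colorings of different components be combined.\<close>

lemma ex_cfc_coloring_below:
  assumes fin: "finite (edges G)"
    and joined: "\<And>u v. \<lbrakk>u \<in> verts G; v \<in> verts G\<rbrakk> \<Longrightarrow> joined (edges G) u v"
    and "cfc G \<le> n"
  obtains c :: "'a set \<Rightarrow> nat" where "c ` edges G \<subseteq> {..<n}" "conflict_free_connected G c"
proof -
  obtain c :: "'a set \<Rightarrow> nat" where c: "card (c ` edges G) = cfc G" "conflict_free_connected G c"
    using ex_cfc_coloring[OF fin joined] by blast
  have "finite (c ` edges G)" using fin by simp
  then obtain g where g: "g ` c ` edges G \<subseteq> {..<n}" "inj_on g (c ` edges G)"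
    using card_le_inj[of "c ` edges G" "{..<n}"] c(1) assms(3) by auto
  have "conflict_free_connected G (g \<circ> c)"
    unfolding conflict_free_connected_iff
  proof (intro ballI impI)
    fix u v assume uv: "u \<in> verts G" "v \<in> verts G" "u \<noteq> v"
    then obtain P k where P: "upath (edges G) u P v" "card {e \<in> path_edges P. c e = k} = 1"
      using c(2) unfolding conflict_free_connected_iff by blast
    then obtain e where e: "{e \<in> path_edges P. c e = k} = {e}" by (auto simp: card_1_singleton_iff)
    have "{f \<in> path_edges P. (g \<circ> c) f = g k} = {f \<in> path_edges P. c f = k}"
    proof -
      have "path_edges P \<subseteq> edges G" "c e = k" "e \<in> path_edges P" using P(1) e by (auto simp: upath_def)
      then have "g (c f) = g k \<longleftrightarrow> c f = k" if "f \<in> path_edges P" for f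
        using inj_on_eq_iff[OF g(2), of "c f" k] that by blast
      then show ?thesis by auto
    qed
    then show "\<exists>P. upath (edges G) u P v \<and> (\<exists>k. card {e \<in> path_edges P. (g \<circ> c) e = k} = 1)"
      using P by metis
  qed
  then show thesis using that[of "g \<circ> c"] g(1) by (simp add: image_comp)
qed

end

lemma cfc_le:
  fixes c :: "'a set \<Rightarrow> nat"
  shows "conflict_free_connected G c \<Longrightarrow> cfc G \<le> card (c ` edges G)"
  unfolding cfc_def by (rule Least_le) blast

lemma vcfc_le:
  fixes c :: "'a \<Rightarrow> nat"
  shows "conflict_free_vertex_connected G c \<Longrightarrow> vcfc G \<le> card (c ` verts G)"
  unfolding vcfc_def by (rule Least_le) blast

section \<open>Cut-edges as bridges\<close>

context graph
begin

lemma finite_edges_graph: "finite (edges G)"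
  by (simp add: edges_def)

lemma edge_subset_verts: "e \<in> edges G \<Longrightarrow> e \<subseteq> verts G"
  by (auto simp: edges_def edge_of_def)

lemma connected_graph_edges:
  assumes "connected G"
  shows "connected_graph (verts G) (edges G)"
proof
  fix e assume "e \<in> edges G"
  then obtain a where a: "a \<in> arcs G" "e = {tail G a, head G a}" by (auto simp: edges_def edge_of_def)
  show "\<exists>x y. e = {x, y} \<and> x \<noteq> y \<and> x \<in> verts G \<and> y \<in> verts G"
    using a no_loops[OF a(1)] by (intro exI[of _ "tail G a"] exI[of _ "head G a"]) simp
next
  show "\<And>u v. u \<in> verts G \<Longrightarrow> v \<in> verts G \<Longrightarrow> joined (edges G) u v"
    using assms by (simp add: connected_iff_joined)
qed

lemma sym_digraph_delete_edge: "sym_digraph (delete_edge G e)"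
proof
  show "symmetric (delete_edge G e)"
    unfolding symmetric_conv
  proof
    fix a assume "a \<in> arcs (delete_edge G e)"
    then have a: "a \<in> arcs G" "edge_of G a \<noteq> e" by (auto simp: delete_edge_def)
    then obtain b where b: "b \<in> arcs G" "tail G a = head G b" "head G a = tail G b"
      using sym_arcs unfolding symmetric_conv by blast
    then have "edge_of G b = edge_of G a" by (auto simp: edge_of_def)
    then show "\<exists>b\<in>arcs (delete_edge G e). tail (delete_edge G e) a = head (delete_edge G e) b \<and>
        head (delete_edge G e) a = tail (delete_edge G e) b"
      using a b by (auto simp: delete_edge_def)
  qed
qed (auto simp: delete_edge_def)

lemma cut_edges_eq_bridges:
  assumes "connected G"
  shows "cut_edges G = connected_graph.bridges (edges G)"
proof -
  interpret cg: connected_graph "verts G" "edges G" using connected_graph_edges[OF assms] .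
  have "connected (delete_edge G e) \<longleftrightarrow> e \<notin> cg.bridges" if e: "e \<in> edges G" for e
  proof -
    have "connected (delete_edge G e) \<longleftrightarrow> (\<forall>u\<in>verts G. \<forall>v\<in>verts G. joined (edges G - {e}) u v)"
    proof -
      have "verts (delete_edge G e) = verts G" by (simp add: delete_edge_def)
      moreover have "verts G \<noteq> {}" using assms by (simp add: connected_iff_joined)
      ultimately show ?thesis
        by (simp add: sym_digraph.connected_iff_joined[OF sym_digraph_delete_edge] edges_delete_edge)
    qed
    also have "\<dots> \<longleftrightarrow> e \<notin> cg.bridges"
    proof
      assume "\<forall>u\<in>verts G. \<forall>v\<in>verts G. joined (edges G - {e}) u v"
      then show "e \<notin> cg.bridges" using edge_subset_verts[OF e] by (auto simp: cg.bridges_def)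
    next
      assume nb: "e \<notin> cg.bridges"
      \<comment> \<open>Only the edge \<open>e\<close> itself has to be bypassed.\<close>
      have "joined (edges G - {e}) x y" if "{x, y} \<in> edges G" for x y
        using that nb cg.joined_of_not_bridge[of x y] joined_edge[of x y "edges G - {e}"]
        by (cases "e = {x, y}") auto
      then show "\<forall>u\<in>verts G. \<forall>v\<in>verts G. joined (edges G - {e}) u v"
        using joined_subst[of "edges G" "edges G - {e}"] cg.joined_all by simp
    qed
    finally show ?thesis .
  qed
  then show ?thesis using cg.bridges_subset unfolding cut_edges_def by blast
qed

end

section \<open>Consequences of the diameter\<close>

context graph
begin

lemma ex_upath_of_diameter:
  assumes "graph_diameter G = 4" "u \<in> verts G" "v \<in> verts G"
  shows "\<exists>P. upath (edges G) u P v \<and> length P \<le> 5"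
proof -
  have "\<mu> (\<lambda>_. 1) u v \<le> graph_diameter G"
    unfolding graph_diameter_def using assms(2,3) by (intro SUP_upper2[of u] SUP_upper2[of v]) auto
  \<comment> \<open>Distances are infima, and a strict bound is what yields an actual walk; its
    length is an integer below 5.\<close>
  then have "\<mu> (\<lambda>_. 1) u v < 5"
    using assms(1) by (simp add: le_less_trans)
  then obtain p where p: "awalk u p v" "ereal (awalk_cost (\<lambda>_. 1) p) < 5"
    by (auto simp: \<mu>_def INF_less_iff)
  have "awalk_cost (\<lambda>_. 1) p = length p" by (induction p) auto
  then have "length p < 5" using p(2) by simp
  \<comment> \<open>The arcs of \<open>q\<close> are distinct and among those of \<open>p\<close>,
    so \<open>q\<close> is not longer.\<close>
  define q where "q = awalk_to_apath p"
  have q: "apath u q v" "set q \<subseteq> set p"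
    using apath_awalk_to_apath awalk_to_apath_subset p(1) by (auto simp: q_def)
  then have "distinct q" by (auto simp: apath_def intro: distinct_verts_imp_distinct)
  then have "length q = card (set q)" by (simp add: distinct_card)
  also have "\<dots> \<le> card (set p)" using q(2) by (simp add: card_mono)
  also have "\<dots> \<le> length p" by (rule card_length)
  finally have "length (awalk_verts u q) \<le> 5"
    using \<open>length p < 5\<close> by (simp add: length_awalk_verts)
  then show ?thesis using upath_of_apath(1)[OF q(1)] by blast
qed

lemma ex_nonadjacent_of_diameter:
  assumes "graph_diameter G = 4"
  shows "\<exists>u\<in>verts G. \<exists>v\<in>verts G. u \<noteq> v \<and> {u, v} \<notin> edges G"
proof (rule ccontr)
  assume no: "\<not> ?thesis"
  have "\<mu> (\<lambda>_. 1) u v \<le> 1" if "u \<in> verts G" "v \<in> verts G" for u v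
  proof (cases "u = v")
    case True
    then have "awalk u [] v" using that by (simp add: awalk_Nil_iff)
    from min_cost_le_walk_cost[OF this, of "\<lambda>_. 1"] show ?thesis
      by (simp add: order_trans)
  next
    case False
    then have "{u, v} \<in> edges G" using no that by blast
    then obtain a where a: "a \<in> arcs G" "tail G a = u" "head G a = v"
      by (rule edge_arc)
    then have "awalk u [a] v" using arc_implies_awalk[of a] by simp
    from min_cost_le_walk_cost[OF this, of "\<lambda>_. 1"] show ?thesis by (simp add: one_ereal_def)
  qed
  then have "graph_diameter G \<le> 1"
    unfolding graph_diameter_def by (intro SUP_least)
  then show False using assms by simp
qed

end

text \<open>The only color occurs once, so the path is a single edge. Hence one color suffices only
  if all pairs are adjacent; this is used for \<open>G\<close> itself and for components
  \<open>T\<close> with \<open>cfc T \<le> 1\<close>.\<close>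

lemma upath_monochromatic:
  assumes P: "upath E u P v" and c: "\<And>e. e \<in> E \<Longrightarrow> c e = i" and k: "card {e \<in> path_edges P. c e = k} = 1"
  shows "path_edges P = {{u, v}}"
proof -
  have PE: "path_edges P \<subseteq> E" using P by (simp add: upath_def)
  obtain e where e: "{e \<in> path_edges P. c e = k} = {e}" using k by (auto simp: card_1_singleton_iff)
  then have "e \<in> path_edges P" "c e = k" by blast+
  then have "k = i" using PE c by auto
  then have "path_edges P = {e}" using e PE c by auto
  then have "length P - 1 = 1" using P card_path_edges[of P] by (simp add: upath_def)
  then obtain x y where "P = [x, y]"
    by (cases P rule: path_edges.cases) (auto simp: length_Suc_conv)
  then show ?thesis using P by (auto simp: upath_def)
qed

lemma (in graph) two_le_cfc:
  assumes "connected G" "graph_diameter G = 4"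
  shows "2 \<le> cfc G"
proof (rule ccontr)
  assume "\<not> 2 \<le> cfc G"
  then have "cfc G \<le> 1" by simp
  then obtain c :: "'a set \<Rightarrow> nat" where c: "c ` edges G \<subseteq> {..<1}" "conflict_free_connected G c"
    using ex_cfc_coloring_below[OF finite_edges_graph] assms(1) connected_iff_joined by metis
  obtain u v where uv: "u \<in> verts G" "v \<in> verts G" "u \<noteq> v" "{u, v} \<notin> edges G"
    using ex_nonadjacent_of_diameter[OF assms(2)] by blast
  then obtain P k where P: "upath (edges G) u P v" "card {e \<in> path_edges P. c e = k} = 1"
    using c(2) unfolding conflict_free_connected_iff by blast
  have "path_edges P = {{u, v}}" using upath_monochromatic[OF P(1) _ P(2), of 0] c(1) by auto
  then show False using P(1) uv(4) by (simp add: upath_def)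
qed

lemma (in graph) vcfc_le_3:
  assumes "connected G" "graph_diameter G = 4"
  shows "vcfc G \<le> 3"
proof -
  interpret cg: connected_graph "verts G" "edges G" using connected_graph_edges[OF assms(1)] .
  have "verts G \<noteq> {}" using assms(1) by (simp add: connected_iff_joined)
  then obtain c where c: "c \<in> verts G"
    "\<And>a a' x. \<lbrakk>a' \<in> verts G; x \<in> verts G; separates (edges G) a a' c\<rbrakk> \<Longrightarrow> \<not> separates (edges G) a' x c"
    using cg.ex_center ex_upath_of_diameter[OF assms(2)] by metis
  define f where "f v = (if v = c then 2 else if cg.cut_vertex v then 1 else 0 :: nat)" for v
  have "conflict_free_vertex_connected G f"
    unfolding conflict_free_vertex_connected_iff
    unfolding f_def
  proof (intro ballI impI, rule cg.ex_conflict_free_vertex_coloring[OF c(1)])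
    fix a a' x assume "a' \<in> verts G" "x \<in> verts G" "separates (edges G) a a' c"
    then show "\<not> separates (edges G) a' x c" by (rule c(2))
  qed
  then have "vcfc G \<le> card (f ` verts G)" by (rule vcfc_le)
  also have "\<dots> \<le> card {0, 1, 2 :: nat}" by (intro card_mono) (auto simp: f_def)
  finally show ?thesis by simp
qed

section \<open>Components of the bridge forest\<close>

lemma edges_cut_edge_graph: "edges (cut_edge_graph G) = cut_edges G"
proof -
  have "edge_of (cut_edge_graph G) = edge_of G" by (simp add: edge_of_def cut_edge_graph_def fun_eq_iff)
  then show ?thesis by (auto simp: edges_def cut_edge_graph_def cut_edges_def)
qed

context graph
begin

lemma sym_digraph_cut_edge_graph: "sym_digraph (cut_edge_graph G)"
proof
  show "symmetric (cut_edge_graph G)"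
    unfolding symmetric_conv
  proof
    fix a assume "a \<in> arcs (cut_edge_graph G)"
    then have a: "a \<in> arcs G" "edge_of G a \<in> cut_edges G" by (auto simp: cut_edge_graph_def)
    then obtain b where b: "b \<in> arcs G" "tail G a = head G b" "head G a = tail G b"
      using sym_arcs unfolding symmetric_conv by blast
    then have "edge_of G b = edge_of G a" by (auto simp: edge_of_def)
    then show "\<exists>b\<in>arcs (cut_edge_graph G). tail (cut_edge_graph G) a = head (cut_edge_graph G) b \<and>
        head (cut_edge_graph G) a = tail (cut_edge_graph G) b"
      using a b by (auto simp: cut_edge_graph_def)
  qed
qed (auto simp: cut_edge_graph_def edge_of_def)

lemma fin_digraph_cut_edge_graph: "fin_digraph (cut_edge_graph G)"
proof -
  interpret H: sym_digraph "cut_edge_graph G" by (rule sym_digraph_cut_edge_graph)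
  have "verts (cut_edge_graph G) \<subseteq> verts G"
    using edge_subset_verts by (auto simp: cut_edge_graph_def cut_edges_def)
  then have "finite (verts (cut_edge_graph G))" by (rule finite_subset) simp
  then show ?thesis by (intro H.fin_digraphI) (auto simp: cut_edge_graph_def)
qed

abbreviation components :: "('a, 'b) pre_digraph set" where
  "components \<equiv> pre_digraph.sccs (cut_edge_graph G)"

lemma finite_components: "finite components"
proof -
  interpret H: fin_digraph "cut_edge_graph G" by (rule fin_digraph_cut_edge_graph)
  show ?thesis unfolding H.sccs_conv_sccs_verts by (rule finite_imageI[OF H.finite_sccs_verts])
qed

text \<open>A strongly connected component is an induced subgraph of a symmetric digraph and
  therefore symmetric, so the results on vertex lists apply to it.\<close>

lemma component_facts:
  assumes T: "T \<in> components"
  shows "sym_digraph T" "edges T \<subseteq> cut_edges G" "verts T \<subseteq> verts G"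
    "\<lbrakk>u \<in> verts T; v \<in> verts T\<rbrakk> \<Longrightarrow> joined (edges T) u v"
proof -
  interpret H: sym_digraph "cut_edge_graph G" by (rule sym_digraph_cut_edge_graph)
  have ind: "induced_subgraph T (cut_edge_graph G)" using H.in_sccs_imp_induced[OF T] .
  then show sym: "sym_digraph T" by (rule H.induced_graph_imp_graph)
  then interpret T: sym_digraph T .
  have sub: "arcs T \<subseteq> arcs (cut_edge_graph G)" "verts T \<subseteq> verts (cut_edge_graph G)"
    "tail (cut_edge_graph G) = tail T" "head (cut_edge_graph G) = head T"
    using ind unfolding induced_subgraph_def subgraph_def compatible_def by blast+
  have "edge_of T a = edge_of (cut_edge_graph G) a" for a unfolding edge_of_def sub(3,4) ..
  then have "edges T \<subseteq> edges (cut_edge_graph G)" using sub(1) unfolding edges_def by blast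
  then show "edges T \<subseteq> cut_edges G" by (simp add: edges_cut_edge_graph)
  have "verts (cut_edge_graph G) \<subseteq> verts G"
    using edge_subset_verts by (auto simp: cut_edge_graph_def cut_edges_def)
  then show "verts T \<subseteq> verts G" using sub by blast
  show "joined (edges T) u v" if "u \<in> verts T" "v \<in> verts T"
    using T that T.reachable_iff_joined by (auto simp: H.sccs_def strongly_connected_def)
qed

lemma finite_edges_component: "T \<in> components \<Longrightarrow> finite (edges T)"
  using component_facts(2) finite_edges_graph
  by (metis (no_types, lifting) cut_edges_def finite_subset mem_Collect_eq subsetI)

lemma component_unique:
  assumes "T \<in> components" "T' \<in> components" "e \<in> edges T" "e \<in> edges T'"
  shows "T = T'"
proof (rule ccontr)
  assume "T \<noteq> T'"
  interpret H: sym_digraph "cut_edge_graph G" by (rule sym_digraph_cut_edge_graph)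
  interpret T: sym_digraph T using component_facts(1) assms(1) .
  interpret T': sym_digraph T' using component_facts(1) assms(2) .
  have "verts T \<inter> verts T' = {}"
    using H.scc_disj[OF assms(1,2) \<open>T \<noteq> T'\<close>] .
  moreover have "e \<subseteq> verts T" "e \<noteq> {}" using assms(3) by (auto simp: edges_def edge_of_def)
  moreover have "e \<subseteq> verts T'" using assms(4) by (auto simp: edges_def edge_of_def)
  ultimately show False by blast
qed

lemma ex_component:
  assumes "upath (cut_edges G) u P v" "u \<noteq> v"
  shows "\<exists>T\<in>components. u \<in> verts T \<and> v \<in> verts T"
proof -
  interpret H: sym_digraph "cut_edge_graph G" by (rule sym_digraph_cut_edge_graph)
  \<comment> \<open>Only ends of cut-edges are vertices of \<open>cut_edge_graph G\<close>;
    \<open>u \<noteq> v\<close> provides a first edge of \<open>P\<close>.\<close>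
  have "\<exists>e\<in>cut_edges G. u \<in> e"
    using assms by (cases P rule: path_edges.cases) (auto simp: upath_def)
  then have u: "u \<in> verts (cut_edge_graph G)" by (simp add: cut_edge_graph_def)
  have "joined (edges (cut_edge_graph G)) u v"
    using assms by (auto simp: joined_def edges_cut_edge_graph)
  then have "u \<rightarrow>\<^sup>*\<^bsub>cut_edge_graph G\<^esub> v" using H.reachable_iff_joined u by simp
  moreover have "u \<rightarrow>\<^sup>*\<^bsub>cut_edge_graph G\<^esub> u" using u by simp
  ultimately show ?thesis
    using H.induce_reachable_is_in_sccs[OF u] by (intro bexI) auto
qed

lemma cfc_component_le_h_number:
  assumes "T \<in> components"
  shows "cfc T \<le> h_number G"
proof (cases "cut_edges G = {}")
  case True
  interpret H: sym_digraph "cut_edge_graph G" by (rule sym_digraph_cut_edge_graph)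
  have "verts (cut_edge_graph G) = {}" using True by (simp add: cut_edge_graph_def)
  moreover have "verts T \<subseteq> verts (cut_edge_graph G)" "verts T \<noteq> {}"
    using assms by (auto simp: H.sccs_def strongly_connected_def)
  ultimately show ?thesis by simp
next
  case False
  then show ?thesis unfolding h_number_def using assms finite_components by simp
qed

lemma h_number_attained:
  assumes "cut_edges G \<noteq> {}"
  shows "\<exists>T\<in>components. h_number G = cfc T"
proof -
  interpret H: sym_digraph "cut_edge_graph G" by (rule sym_digraph_cut_edge_graph)
  have "edges (cut_edge_graph G) \<noteq> {}" using assms by (simp add: edges_cut_edge_graph)
  then have "verts (cut_edge_graph G) \<noteq> {}" using H.tail_in_verts unfolding edges_def by blast
  then have "components \<noteq> {}" using H.exists_scc by blast
  then have "h_number G \<in> cfc ` components"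
    unfolding h_number_def using assms finite_components by simp
  then show ?thesis by blast
qed

end

section \<open>Edge-colorings of graphs of diameter 4\<close>

lemma (in graph) cfc_le_2:
  assumes con: "connected G" and "h_number G \<le> 1"
  shows "cfc G \<le> 2"
proof -
  interpret cg: connected_graph "verts G" "edges G" using connected_graph_edges[OF con] .
  have bridges: "cut_edges G = cg.bridges" using cut_edges_eq_bridges[OF con] .
  obtain S where S: "cg.transversal S" using cg.ex_disjoint_transversals by metis
  define c where "c e = (if e \<in> S then 1 else 0 :: nat)" for e
  have "conflict_free_connected G c"
    unfolding conflict_free_connected_iff
  proof (intro ballI impI)
    fix u v assume uv: "u \<in> verts G" "v \<in> verts G" "u \<noteq> v"
    obtain P where "upath (edges G) u P v" "\<forall>Q. upath (edges G) u Q v \<longrightarrow> length P \<le> length Q"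
      using cg.ex_shortest_upath[OF uv(1,2)] .
    note P = this(1) this(2)[rule_format]
    show "\<exists>P. upath (edges G) u P v \<and> (\<exists>k. card {e \<in> path_edges P. c e = k} = 1)"
    proof (cases "path_edges P \<subseteq> cg.bridges")
      case False
      then obtain f where f: "f \<in> path_edges P" "f \<notin> cg.bridges" by blast
      show ?thesis using cg.conflict_free_via_transversal[OF P f uv(1,2) S] unfolding c_def .
    next
      case True
      then have "upath (cut_edges G) u P v" using P(1) bridges upath_mono by metis
      then obtain T where T: "T \<in> components" "u \<in> verts T" "v \<in> verts T"
        using ex_component[OF _ uv(3)] by blast
      interpret T: sym_digraph T using component_facts(1)[OF T(1)] .
      have "cfc T \<le> 1" using cfc_component_le_h_number[OF T(1)] assms(2) by simp
      then obtain d :: "'a set \<Rightarrow> nat" where d: "d ` edges T \<subseteq> {..<1}" "conflict_free_connected T d"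
        using T.ex_cfc_coloring_below[OF finite_edges_component[OF T(1)] component_facts(4)[OF T(1)]] by blast
      obtain Q k where Q: "upath (edges T) u Q v" "card {e \<in> path_edges Q. d e = k} = 1"
        using d(2) T(2,3) uv(3) unfolding T.conflict_free_connected_iff by blast
      \<comment> \<open>So \<open>u\<close> and \<open>v\<close> are adjacent, and a single edge is
        conflict-free under every coloring.\<close>
      have Quv: "path_edges Q = {{u, v}}" using upath_monochromatic[OF Q(1) _ Q(2), of 0] d(1) by auto
      have "path_edges Q \<subseteq> edges G"
        using Q(1) component_facts(2)[OF T(1)] by (auto simp: upath_def cut_edges_def)
      then have "upath (edges G) u Q v" using upath_mono Q(1) by metis
      moreover have "{e \<in> path_edges Q. c e = c {u, v}} = {{u, v}}" using Quv by auto
      then have "card {e \<in> path_edges Q. c e = c {u, v}} = 1" by simp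
      ultimately show ?thesis by blast
    qed
  qed
  then have "cfc G \<le> card (c ` edges G)" by (rule cfc_le)
  also have "\<dots> \<le> card {0, 1 :: nat}" by (intro card_mono) (auto simp: c_def)
  finally show ?thesis by simp
qed

text \<open>An optimal coloring of \<open>G\<close> is restricted to \<open>T\<close>. A
  conflict-free path in \<open>G\<close> between vertices of \<open>T\<close> has the same edges as
  the path in \<open>T\<close>, as the latter consists of bridges.\<close>

lemma (in graph) cfc_component_le_cfc:
  assumes con: "connected G" and T: "T \<in> components"
  shows "cfc T \<le> cfc G"
proof -
  interpret cg: connected_graph "verts G" "edges G" using connected_graph_edges[OF con] .
  interpret T: sym_digraph T using component_facts(1)[OF T] .
  have TG: "edges T \<subseteq> edges G" "edges T \<subseteq> cg.bridges"
    using component_facts(2)[OF T] cut_edges_eq_bridges[OF con] cg.bridges_subset by auto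
  obtain c :: "'a set \<Rightarrow> nat" where c: "card (c ` edges G) = cfc G" "conflict_free_connected G c"
    using ex_cfc_coloring[OF finite_edges_graph cg.joined_all] by blast
  have "conflict_free_connected T c"
    unfolding T.conflict_free_connected_iff
  proof (intro ballI impI)
    fix u v assume uv: "u \<in> verts T" "v \<in> verts T" "u \<noteq> v"
    then obtain P where P: "upath (edges T) u P v"
      using component_facts(4)[OF T] unfolding joined_def by blast
    have "u \<in> verts G" "v \<in> verts G" using uv component_facts(3)[OF T] by auto
    then obtain Q k where Q: "upath (edges G) u Q v" "card {e \<in> path_edges Q. c e = k} = 1"
      using c(2) uv(3) unfolding conflict_free_connected_iff by blast
    have "upath (edges G) u P v" "path_edges P \<subseteq> cg.bridges"
      using P TG by (auto simp: upath_def)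
    then have "path_edges Q = path_edges P" using cg.bridge_path_unique Q(1) by blast
    then have "card {e \<in> path_edges P. c e = k} = 1" using Q(2) by simp
    then show "\<exists>P. upath (edges T) u P v \<and> (\<exists>k. card {e \<in> path_edges P. c e = k} = 1)"
      using P by blast
  qed
  then have "cfc T \<le> card (c ` edges T)" by (rule cfc_le)
  also have "\<dots> \<le> card (c ` edges G)"
    using TG(1) finite_edges_graph by (intro card_mono image_mono) auto
  finally show ?thesis using c(1) by simp
qed

lemma (in graph) ex_component_edge:
  assumes con: "connected G" and e: "e \<in> cut_edges G"
  shows "\<exists>T\<in>components. e \<in> edges T"
proof -
  interpret cg: connected_graph "verts G" "edges G" using connected_graph_edges[OF con] .
  have eE: "e \<in> edges G" "e \<in> cg.bridges" using e cut_edges_eq_bridges[OF con] by (auto simp: cut_edges_def)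
  obtain u v where uv: "e = {u, v}" "u \<noteq> v" using cg.edge_ends[OF eE(1)] by blast
  then have "upath (cut_edges G) u [u, v] v" using e by (simp add: upath_def)
  then obtain T where T: "T \<in> components" "u \<in> verts T" "v \<in> verts T"
    using ex_component[OF _ uv(2)] by blast
  then obtain P where P: "upath (edges T) u P v"
    using component_facts(4) unfolding joined_def by metis
  moreover have "edges T \<subseteq> edges G" using component_facts(2)[OF T(1)] by (auto simp: cut_edges_def)
  ultimately have "upath (edges G) u P v" by (auto simp: upath_def)
  moreover have "upath (edges G) u [u, v] v" using eE uv by (simp add: upath_def)
  \<comment> \<open>The component is found through the ends of \<open>e\<close>; being a bridge,
    \<open>e\<close> lies on every path between them.\<close>
  ultimately have "e \<in> path_edges P"
    using cg.bridges_on_paths[of u "[u, v]" v P e] eE uv by simp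
  then show ?thesis using P T(1) by (auto simp: upath_def)
qed

lemma (in graph) ex_component_coloring:
  assumes con: "connected G"
  obtains d :: "'a set \<Rightarrow> nat" where "d ` cut_edges G \<subseteq> {..<h_number G}"
    "\<And>T. T \<in> components \<Longrightarrow> conflict_free_connected T d"
proof -
  have "\<exists>d :: 'a set \<Rightarrow> nat. d ` edges T \<subseteq> {..<h_number G} \<and> conflict_free_connected T d"
    if T: "T \<in> components" for T
  proof -
    interpret T: sym_digraph T using component_facts(1)[OF T] .
    obtain d :: "'a set \<Rightarrow> nat" where "d ` edges T \<subseteq> {..<h_number G}" "conflict_free_connected T d"
      by (rule T.ex_cfc_coloring_below[OF finite_edges_component[OF T] component_facts(4)[OF T]
            cfc_component_le_h_number[OF T]])
    then show ?thesis by blast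
  qed
  then obtain D :: "('a, 'b) pre_digraph \<Rightarrow> 'a set \<Rightarrow> nat" where
    D: "\<forall>T\<in>components. D T ` edges T \<subseteq> {..<h_number G} \<and> conflict_free_connected T (D T)"
    using bchoice[of components "\<lambda>T d. d ` edges T \<subseteq> {..<h_number G} \<and> conflict_free_connected T d"]
    by blast
  \<comment> \<open>Components share no edge, so the chosen colorings combine to one.\<close>
  define d where "d e = D (THE T. T \<in> components \<and> e \<in> edges T) e" for e
  have d_eq: "d e = D T e" if "T \<in> components" "e \<in> edges T" for T e
  proof -
    have "(THE T. T \<in> components \<and> e \<in> edges T) = T"
      using that component_unique by (intro the_equality) blast+
    then show ?thesis by (simp add: d_def)
  qed
  have "conflict_free_connected T d" if T: "T \<in> components" for T
  proof -
    interpret T: sym_digraph T using component_facts(1)[OF T] .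
    have DT: "conflict_free_connected T (D T)" using bspec[OF D T] by (rule conjunct2)
    show ?thesis
      unfolding T.conflict_free_connected_iff
    proof (intro ballI impI)
      fix u v assume "u \<in> verts T" "v \<in> verts T" "u \<noteq> v"
      then obtain P k where P: "upath (edges T) u P v" "card {e \<in> path_edges P. D T e = k} = 1"
        using DT[unfolded T.conflict_free_connected_iff] by blast
      have "d e = D T e" if "e \<in> path_edges P" for e
        using d_eq[OF T] that P(1) by (auto simp: upath_def)
      then have "{e \<in> path_edges P. d e = k} = {e \<in> path_edges P. D T e = k}" by auto
      then have "card {e \<in> path_edges P. d e = k} = 1" using P(2) by simp
      then show "\<exists>P. upath (edges T) u P v \<and> (\<exists>k. card {e \<in> path_edges P. d e = k} = 1)"
        using P(1) by blast
    qed
  qed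
  moreover have "d e < h_number G" if e: "e \<in> cut_edges G" for e
  proof -
    obtain T where T: "T \<in> components" "e \<in> edges T" using ex_component_edge[OF con e] by blast
    then show ?thesis using bspec[OF D T(1)] d_eq[OF T] by auto
  qed
  ultimately show thesis using that by blast
qed

lemma (in graph) cfc_le_h_number:
  assumes con: "connected G" and diam: "graph_diameter G = 4" and h: "3 \<le> h_number G"
  shows "cfc G \<le> h_number G"
proof -
  interpret cg: connected_graph "verts G" "edges G" using connected_graph_edges[OF con] .
  have bridges: "cut_edges G = cg.bridges" using cut_edges_eq_bridges[OF con] .
  obtain d :: "'a set \<Rightarrow> nat" where d: "d ` cut_edges G \<subseteq> {..<h_number G}"
    "\<And>T. T \<in> components \<Longrightarrow> conflict_free_connected T d"
    using ex_component_coloring[OF con] by metis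
  obtain S Z where SZ: "cg.transversal S" "cg.transversal Z" "S \<inter> Z = {}"
    using cg.ex_disjoint_transversals .
  \<comment> \<open>The colors 0, 1 and 2 also occur in \<open>d\<close>; \<open>h_number G\<close>
    is at least 3, so no new color is spent on non-bridges.\<close>
  define c where "c e = (if e \<in> S then 0 else if e \<in> Z then 1 else if e \<notin> cg.bridges then 2 else d e)" for e
  have "conflict_free_connected G c"
    unfolding conflict_free_connected_iff
  proof (intro ballI impI)
    fix u v assume uv: "u \<in> verts G" "v \<in> verts G" "u \<noteq> v"
    obtain P where "upath (edges G) u P v" "\<forall>Q. upath (edges G) u Q v \<longrightarrow> length P \<le> length Q"
      using cg.ex_shortest_upath[OF uv(1,2)] .
    note P = this(1) this(2)[rule_format]
    have len: "length P \<le> 5" using ex_upath_of_diameter[OF diam uv(1,2)] P(2) le_trans by blast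
    show "\<exists>P. upath (edges G) u P v \<and> (\<exists>k. card {e \<in> path_edges P. c e = k} = 1)"
    proof (cases "path_edges P \<subseteq> cg.bridges")
      case False
      then obtain f where f: "f \<in> path_edges P" "f \<notin> cg.bridges" by blast
      show ?thesis
        using cg.conflict_free_via_transversals[OF P len f uv(1,2) SZ] c_def by blast
    next
      case True
      then have "upath (cut_edges G) u P v" using P(1) bridges upath_mono by metis
      then obtain T where T: "T \<in> components" "u \<in> verts T" "v \<in> verts T"
        using ex_component[OF _ uv(3)] by blast
      interpret T: sym_digraph T using component_facts(1)[OF T(1)] .
      obtain Q k where Q: "upath (edges T) u Q v" "card {e \<in> path_edges Q. d e = k} = 1"
        using d(2)[OF T(1)] T(2,3) uv(3) unfolding T.conflict_free_connected_iff by blast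
      have Qb: "path_edges Q \<subseteq> cg.bridges"
        using Q(1) component_facts(2)[OF T(1)] bridges by (auto simp: upath_def)
      then have "upath (edges G) u Q v" using upath_mono Q(1) cg.bridges_subset by (metis subset_trans)
      \<comment> \<open>Transversals contain no bridges, so \<open>c\<close> leaves the coloring of
        the components unchanged.\<close>
      moreover have "c e = d e" if "e \<in> path_edges Q" for e
        using that Qb SZ unfolding c_def cg.transversal_def by auto
      then have "{e \<in> path_edges Q. c e = k} = {e \<in> path_edges Q. d e = k}" by auto
      ultimately show ?thesis using Q(2) by metis
    qed
  qed
  then have "cfc G \<le> card (c ` edges G)" by (rule cfc_le)
  also have "\<dots> \<le> card {..<h_number G}"
  proof (intro card_mono subsetI)
    fix k assume "k \<in> c ` edges G"
    then obtain e where e: "e \<in> edges G" "k = c e" by blast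
    then show "k \<in> {..<h_number G}" using d(1) h bridges by (auto simp: c_def)
  qed simp
  finally show ?thesis by simp
qed

theorem theorem3p9:
  fixes G :: "('a, 'b) pre_digraph"
  assumes "graph G"
    and "connected G"
    and "graph_diameter G = 4"
  shows "vcfc G \<le> 3
    \<and> (h_number G \<le> 1 \<longrightarrow> cfc G = 2)
    \<and> (h_number G \<ge> 3 \<longrightarrow> cfc G = h_number G)"
proof -
  interpret graph G by fact
  have "h_number G \<le> cfc G" if "h_number G \<ge> 3"
  proof -
    \<comment> \<open>Without cut-edges \<open>h_number G\<close> takes its default value 0;
      otherwise it is attained by a component.\<close>
    have "cut_edges G \<noteq> {}" using that by (auto simp: h_number_def)
    then show ?thesis using h_number_attained cfc_component_le_cfc[OF assms(2)] by metis
  qed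
  then show ?thesis
    using vcfc_le_3 two_le_cfc cfc_le_2 cfc_le_h_number assms(2,3) by (meson le_antisym)
qed

end
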